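(* Let $\ell\ge 0$ be an integer. Let $\mathbf a$ be a univariate mask such that the stationary binary subdivision scheme $S_{\mathbf a}$ is convergent and its basic refinable limit function $\phi$ (the limit function for the initial data $\boldsymbol\delta$) is stable. Let $\{\mathbf a^{(k)},\ k\ge 1\}$ be univariate masks with $a_*^{(k)}(1)=2$ for all $k\ge 1$ and $\lim_{k\to\infty}\mathbf a^{(k)}=\mathbf a$, and assume that the non-stationary binary subdivision scheme $\{S_{\mathbf a^{(k)}},\ k\ge 1\}$ converges to $C^\ell$ limit functions. Then $$\lim_{k\to\infty}2^{\ell k}\,\delta_k=0,\qquad\text{where}\quad \delta_k:=\max_{0\le j\le \ell}2^{-kj}\,\bigl|D^j a_*^{(k)}(-1)\bigr| .$$
   Context: Here the dimension is $s=1$ and the dilation is $M=2$. All masks are real sequences $\mathbf a=\{\mathrm a(\alpha)\}_{\alpha\in\mathbb Z}$ supported in $\{0,\dots,N\}$ for one fixed $N\in\mathbb N$; $\lim_k \mathbf a^{(k)}=\mathbf a$ means entrywise convergence. The symbol of $\mathbf a$ is $a_*(z)=\sum_{\alpha\in\mathbb Z}\mathrm a(\alpha)z^\alpha$, $z\in\mathbb C\setminus\{0\}$, and $D^j$ is the $j$-th derivative in $z$. The subdivision operator is $(S_{\mathbf a}\boldsymbol c)(\alpha)=\sum_{\beta\in\mathbb Z}\mathrm a(\alpha-2\beta)c(\beta)$. The scheme $\{S_{\mathbf a^{(k)}},k\ge1\}$ converges to $C^\ell$ limit functions if for every $\boldsymbol c\in\ell_\infty(\mathbb Z)$ there is a function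 $g_{\boldsymbol c}\in C^\ell(\mathbb R)$ (nonzero for at least one nonzero $\boldsymbol c$) with $$\lim_{k\to\infty}\ \sup_{\alpha\in\mathbb Z}\bigl|g_{\boldsymbol c}(2^{-k}\alpha)-(S_{\mathbf a^{(k)}}S_{\mathbf a^{(k-1)}}\cdots S_{\mathbf a^{(1)}}\boldsymbol c)(\alpha)\bigr|=0 .$$ The stationary scheme $S_{\mathbf a}$ is the case $\mathbf a^{(k)}=\mathbf a$ for all $k$; it is convergent if it converges to $C^0$ limit functions. $\boldsymbol\delta$ is the sequence with $\delta(0)=1$ and $\delta(\alpha)=0$ for $\alpha\neq0$. A compactly supported $f\in L_\infty(\mathbb R)$ is stable if there are $0<C_1\le C_2<\infty$ with $C_1\|\boldsymbol c\|_{\ell_\infty}\le\|\sum_{\alpha\in\mathbb Z}c(\alpha)f(\cdot-\alpha)\|_\infty\le C_2\|\boldsymbol c\|_{\ell_\infty}$ for all $\boldsymbol c\in\ell_\infty(\mathbb Z)$. *)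

theory Defs
  imports "HOL-Analysis.Analysis" "HOL-Probability.Essential_Supremum"
begin

(* Bi-infinite real sequences are functions int => real. *)

definition mask_supp :: "nat \<Rightarrow> (int \<Rightarrow> real) \<Rightarrow> bool" where
  "mask_supp N a \<longleftrightarrow> {\<alpha>. a \<alpha> \<noteq> 0} \<subseteq> {0..int N}"

definition mask_symbol :: "(int \<Rightarrow> real) \<Rightarrow> complex \<Rightarrow> complex" where
  "mask_symbol a z = (\<Sum>\<^sub>\<infinity>\<alpha>::int. of_real (a \<alpha>) * z powi \<alpha>)"

definition subdivision :: "(int \<Rightarrow> real) \<Rightarrow> (int \<Rightarrow> real) \<Rightarrow> int \<Rightarrow> real" where
  "subdivision a c \<alpha> = (\<Sum>\<^sub>\<infinity>\<beta>::int. a (\<alpha> - 2 * \<beta>) * c \<beta>)"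

(* The masks of a scheme are A 1, A 2, ...; the value A 0 is never used. *)
primrec subdivision_iter ::
    "(nat \<Rightarrow> int \<Rightarrow> real) \<Rightarrow> nat \<Rightarrow> (int \<Rightarrow> real) \<Rightarrow> int \<Rightarrow> real" where
  "subdivision_iter A 0 c = c"
| "subdivision_iter A (Suc k) c = subdivision (A (Suc k)) (subdivision_iter A k c)"

definition delta_seq :: "int \<Rightarrow> real" where
  "delta_seq \<alpha> = (if \<alpha> = 0 then 1 else 0)"

definition C_diff :: "nat \<Rightarrow> (real \<Rightarrow> real) \<Rightarrow> bool" where
  "C_diff l f \<longleftrightarrow>
     (\<forall>j<l. \<forall>x. ((deriv ^^ j) f) field_differentiable (at x)) \<and>
     continuous_on UNIV ((deriv ^^ l) f)"

(* Suprema are taken in ereal: on type real, SUP is unspecified for unbounded families. *)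
definition limit_function ::
    "nat \<Rightarrow> (nat \<Rightarrow> int \<Rightarrow> real) \<Rightarrow> (int \<Rightarrow> real) \<Rightarrow> (real \<Rightarrow> real) \<Rightarrow> bool" where
  "limit_function l A c g \<longleftrightarrow>
     C_diff l g \<and>
     (\<lambda>k. SUP \<alpha>::int. ereal \<bar>g (of_int \<alpha> / 2 ^ k) - subdivision_iter A k c \<alpha>\<bar>) \<longlonglongrightarrow> 0"

definition converges_to :: "nat \<Rightarrow> (nat \<Rightarrow> int \<Rightarrow> real) \<Rightarrow> bool" where
  "converges_to l A \<longleftrightarrow>
     (\<exists>G. (\<forall>c. bounded (range c) \<longrightarrow> limit_function l A c (G c)) \<and>
          (\<exists>c. bounded (range c) \<and> c \<noteq> (\<lambda>_. 0) \<and> G c \<noteq> (\<lambda>_. 0)))"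

definition linf_norm :: "(int \<Rightarrow> real) \<Rightarrow> ereal" where
  "linf_norm c = (SUP \<alpha>. ereal \<bar>c \<alpha>\<bar>)"

definition Linf_norm :: "(real \<Rightarrow> real) \<Rightarrow> ereal" where
  "Linf_norm f = esssup lebesgue (\<lambda>x. ereal \<bar>f x\<bar>)"

definition Linf_stable :: "(real \<Rightarrow> real) \<Rightarrow> bool" where
  "Linf_stable f \<longleftrightarrow>
     compact (closure {x. f x \<noteq> 0}) \<and>
     f \<in> borel_measurable lebesgue \<and> Linf_norm f < \<infinity> \<and>
     (\<exists>C1 C2. 0 < C1 \<and> C1 \<le> C2 \<and>
        (\<forall>c. bounded (range c) \<longrightarrow>
           ereal C1 * linf_norm c \<le> Linf_norm (\<lambda>x. \<Sum>\<^sub>\<infinity>\<alpha>::int. c \<alpha> * f (x - of_int \<alpha>)) \<and>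
           Linf_norm (\<lambda>x. \<Sum>\<^sub>\<infinity>\<alpha>::int. c \<alpha> * f (x - of_int \<alpha>)) \<le> ereal C2 * linf_norm c))"

definition sum_rule_defect :: "nat \<Rightarrow> (nat \<Rightarrow> int \<Rightarrow> real) \<Rightarrow> nat \<Rightarrow> real" where
  "sum_rule_defect l A k =
     (MAX j\<in>{0..l}. cmod ((deriv ^^ j) (mask_symbol (A k)) (-1)) / 2 ^ (k * j))"

end

theory Submission
  imports Defs
begin

text \<open>
  Write \<open>c k\<close> for the iterate of the delta sequence after \<open>k\<close> steps and \<open>g\<close> for its \<open>C l\<close> limit function.
  Stability makes \<open>\<Sum> (-1)^q \<phi> (x + q)\<close> nonzero, so some Lipschitz function \<open>w\<close> with
  \<open>w (x + 1) = - w x\<close> has \<open>\<integral> \<phi> w > 0\<close>. Antiperiodicity allows one to replace \<open>x^j g\<close> in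
  \<open>\<integral> x^j g(x) w(2^k x) dx\<close> by its \<open>(l + 1)\<close>-st difference of step \<open>2^-k\<close>, so this integral is \<open>o(2^(-l k))\<close>.
  On the other hand, splitting the scheme after \<open>k\<close> steps expands it into the alternating moments
  \<open>\<Sum> (-1)^\<beta> \<beta>^i c k \<beta>\<close>, \<open>i \<le> j\<close>, with coefficients coming from the scheme started at level \<open>k + 1\<close>;
  the leading coefficient tends to \<open>\<integral> \<phi> w\<close>. Hence the alternating moments, then those of the masks, and finally
  the derivatives of the symbols at \<open>-1\<close> are small. The scheme started at level \<open>k + 1\<close> is not known to
  converge, so all integrals are replaced by dyadic sums: these converge, uniformly in \<open>k\<close>, against Lipschitz
  functions because the iterates grow at most like \<open>(3/2)^n\<close>.
\<close>

section \<open>Pairings and subdivision\<close>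

text \<open>Up to sign, derivatives of the symbol at -1 are falling factorial moments of the mask
  twisted by (-1)^\<gamma>, that is, information at frequency pi. Stability excludes that the
  Fourier transform of \<phi> vanishes at all odd multiples of pi; the weight \<open>w\<close> is a
  real-variable substitute for this fact. At \<beta> + y with integer \<beta> it factors as
  (-1)^\<beta> w(y), which separates the first k levels from the later ones.

  The obstacle is that smoothness of \<open>g\<close> is a statement about the product of all masks,
  while the claim concerns each mask alone. The factor x^j is inserted to reach moments of order j;
  the lower orders that it brings along are removed by induction on j. Passing from iterates to
  masks is then a triangular system, whose off-diagonal coefficients are ordinary moments and stay
  bounded.

  A difference of order l would give only O(2^(-l k)); the additional one brings in the modulus of
  continuity of the l-th derivative, hence little o. Since each mask sums to 2, consecutive dyadic
  sums differ by O(2^-n) times the size of the iterate, so any growth rate below 2 is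
  harmless.\<close>

definition pairing :: "(int \<Rightarrow> real) \<Rightarrow> (int \<Rightarrow> real) \<Rightarrow> real" where
  "pairing c f = (\<Sum>\<alpha> | c \<alpha> \<noteq> 0. c \<alpha> * f \<alpha>)"

lemma pairing_superset:
  assumes "finite S" "\<And>\<alpha>. \<alpha> \<notin> S \<Longrightarrow> c \<alpha> = 0"
  shows "pairing c f = (\<Sum>\<alpha>\<in>S. c \<alpha> * f \<alpha>)"
  unfolding pairing_def
  by (rule sum.mono_neutral_left) (use assms in auto)

lemma mask_suppD: "mask_supp L c \<Longrightarrow> \<alpha> \<notin> {0..int L} \<Longrightarrow> c \<alpha> = 0"
  by (auto simp: mask_supp_def)

lemma mask_suppI: "(\<And>\<alpha>. \<alpha> \<notin> {0..int L} \<Longrightarrow> c \<alpha> = 0) \<Longrightarrow> mask_supp L c"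
  unfolding mask_supp_def by blast

lemma mask_supp_mono: "mask_supp L c \<Longrightarrow> L \<le> L' \<Longrightarrow> mask_supp L' c"
  by (force simp: mask_supp_def)

lemma mask_supp_delta: "mask_supp 0 delta_seq"
  by (auto simp: mask_supp_def delta_seq_def)

lemma pairing_mask:
  "mask_supp L c \<Longrightarrow> pairing c f = (\<Sum>\<alpha>\<in>{0..int L}. c \<alpha> * f \<alpha>)"
  by (rule pairing_superset) (auto dest: mask_suppD)

lemma pairing_delta [simp]: "pairing delta_seq f = f 0"
  using pairing_mask[OF mask_supp_delta] by (simp add: delta_seq_def)

lemma pairing_cong:
  "(\<And>\<alpha>. c \<alpha> \<noteq> 0 \<Longrightarrow> f \<alpha> = g \<alpha>) \<Longrightarrow> pairing c f = pairing c g"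
  unfolding pairing_def by (rule sum.cong) auto

lemma pairing_diff: "pairing c (\<lambda>\<alpha>. f \<alpha> - g \<alpha>) = pairing c f - pairing c g"
  by (simp add: pairing_def ring_distribs sum_subtractf)

lemma pairing_sum: "pairing c (\<lambda>\<alpha>. \<Sum>i\<in>I. f i \<alpha>) = (\<Sum>i\<in>I. pairing c (f i))"
  unfolding pairing_def by (simp add: sum_distrib_left) (rule sum.swap)

lemma pairing_scale: "pairing c (\<lambda>\<alpha>. r * f \<alpha>) = r * pairing c f"
  by (simp add: pairing_def sum_distrib_left algebra_simps)

lemma pairing_scale_right: "pairing c (\<lambda>\<alpha>. f \<alpha> * r) = pairing c f * r"
  by (simp add: pairing_def sum_distrib_left sum_distrib_right algebra_simps)

lemma pairing_abs_le:
  assumes "mask_supp L c" and c: "\<And>\<alpha>. \<bar>c \<alpha>\<bar> \<le> b"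
    and f: "\<And>\<alpha>. 0 \<le> \<alpha> \<Longrightarrow> \<alpha> \<le> int L \<Longrightarrow> \<bar>f \<alpha>\<bar> \<le> r"
  shows "\<bar>pairing c f\<bar> \<le> (real L + 1) * (b * r)"
proof -
  have "\<bar>pairing c f\<bar> \<le> (\<Sum>\<alpha>\<in>{0..int L}. \<bar>c \<alpha> * f \<alpha>\<bar>)"
    unfolding pairing_mask[OF assms(1)] by (rule sum_abs)
  also have "\<dots> \<le> (\<Sum>\<alpha>\<in>{0..int L}. b * r)"
    by (rule sum_mono) (use c f in \<open>auto simp: abs_mult intro!: mult_mono order.trans[OF abs_ge_zero c]\<close>)
  also have "\<dots> = (real L + 1) * (b * r)" by simp
  finally show ?thesis .
qed

lemma pairing_shift:
  fixes s :: int
  assumes "finite {\<alpha>. c \<alpha> \<noteq> 0}"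
  shows "pairing (\<lambda>\<alpha>. c (\<alpha> + s)) f = pairing c (\<lambda>\<alpha>. f (\<alpha> - s))"
  unfolding pairing_def
  by (rule sum.reindex_bij_witness[of _ "\<lambda>\<alpha>. \<alpha> - s" "\<lambda>\<alpha>. \<alpha> + s"]) auto

section \<open>Subdivision: supports, adjoint formula, iterates\<close>

lemma subdivision_eq:
  assumes "mask_supp L c"
  shows "subdivision a c \<alpha> = (\<Sum>\<beta>\<in>{0..int L}. a (\<alpha> - 2 * \<beta>) * c \<beta>)"
proof -
  have "subdivision a c \<alpha> = (\<Sum>\<^sub>\<infinity>\<beta>\<in>{0..int L}. a (\<alpha> - 2 * \<beta>) * c \<beta>)"
    unfolding subdivision_def
    by (rule infsum_cong_neutral) (use assms in \<open>auto dest: mask_suppD\<close>)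
  then show ?thesis by simp
qed

lemma mask_supp_subdivision:
  assumes "mask_supp N a" "mask_supp L c"
  shows "mask_supp (2 * L + N) (subdivision a c)"
proof (rule mask_suppI)
  fix \<alpha> assume "\<alpha> \<notin> {0..int (2 * L + N)}"
  then have "a (\<alpha> - 2 * \<beta>) = 0" if "\<beta> \<in> {0..int L}" for \<beta>
    using that by (intro mask_suppD[OF assms(1)]) auto
  then show "subdivision a c \<alpha> = 0"
    by (simp add: subdivision_eq[OF assms(2)])
qed

text \<open>The adjoint of subdivision, by the substitution \<alpha> = 2\<beta> + \<gamma>. Moving
  the operator onto the test function allows polynomials and antiperiodic weights to be expanded
  separately in \<beta> and \<gamma>.\<close>

lemma pairing_subdivision:
  assumes a: "mask_supp N a" and c: "mask_supp L c"
  shows "pairing (subdivision a c) f = pairing c (\<lambda>\<beta>. pairing a (\<lambda>\<gamma>. f (2 * \<beta> + \<gamma>)))"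
proof -
  have "(\<Sum>\<alpha>\<in>{0..int (2 * L + N)}. a (\<alpha> - 2 * \<beta>) * f \<alpha>) = pairing a (\<lambda>\<gamma>. f (2 * \<beta> + \<gamma>))"
    if "\<beta> \<in> {0..int L}" for \<beta>
  proof -
    have "(\<Sum>\<alpha>\<in>{0..int (2 * L + N)}. a (\<alpha> - 2 * \<beta>) * f \<alpha>)
      = (\<Sum>\<gamma>\<in>{- 2 * \<beta>..int (2 * L + N) - 2 * \<beta>}. a \<gamma> * f (2 * \<beta> + \<gamma>))"
      by (rule sum.reindex_bij_witness[of _ "\<lambda>\<gamma>. 2 * \<beta> + \<gamma>" "\<lambda>\<alpha>. \<alpha> - 2 * \<beta>"]) auto
    also have "\<dots> = pairing a (\<lambda>\<gamma>. f (2 * \<beta> + \<gamma>))"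
      by (rule pairing_superset[symmetric])
        (use that in \<open>auto intro!: mask_suppD[OF a]\<close>)
    finally show ?thesis .
  qed
  then have *: "(\<Sum>\<beta>\<in>{0..int L}. c \<beta> * (\<Sum>\<alpha>\<in>{0..int (2 * L + N)}. a (\<alpha> - 2 * \<beta>) * f \<alpha>))
      = pairing c (\<lambda>\<beta>. pairing a (\<lambda>\<gamma>. f (2 * \<beta> + \<gamma>)))"
    by (simp add: pairing_mask[OF c])
  have "pairing (subdivision a c) f
      = (\<Sum>\<alpha>\<in>{0..int (2 * L + N)}. \<Sum>\<beta>\<in>{0..int L}. c \<beta> * (a (\<alpha> - 2 * \<beta>) * f \<alpha>))"
    unfolding pairing_mask[OF mask_supp_subdivision[OF a c]] subdivision_eq[OF c]
    by (simp add: sum_distrib_left sum_distrib_right algebra_simps)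
  also have "\<dots> = (\<Sum>\<beta>\<in>{0..int L}. \<Sum>\<alpha>\<in>{0..int (2 * L + N)}. c \<beta> * (a (\<alpha> - 2 * \<beta>) * f \<alpha>))"
    by (rule sum.swap)
  also have "\<dots> = pairing c (\<lambda>\<beta>. pairing a (\<lambda>\<gamma>. f (2 * \<beta> + \<gamma>)))"
    by (simp add: *[symmetric] sum_distrib_left)
  finally show ?thesis .
qed

lemma mask_supp_iter:
  assumes "\<forall>k\<ge>1. mask_supp N (A k)" "mask_supp L c"
  shows "mask_supp (2 ^ n * L + (2 ^ n - 1) * N) (subdivision_iter A n c)"
proof (induction n)
  case 0 show ?case using assms(2) by simp
next
  case (Suc n)
  have "2 * (2 ^ n * L + (2 ^ n - 1) * N) + N = 2 ^ Suc n * L + (2 ^ Suc n - 1) * N"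
    by (cases "2 ^ n :: nat") (auto simp: algebra_simps)
  then show ?case
    using mask_supp_subdivision[OF assms(1)[rule_format, of "Suc n"] Suc] by (simp only: subdivision_iter.simps)
qed

text \<open>The sharper length (2^n - 1) N is rounded up, so that rescaling by 2^-n gives the same
  interval [0, N] at every level.\<close>

lemma mask_supp_iter_delta:
  assumes "\<forall>k\<ge>1. mask_supp N (A k)"
  shows "mask_supp (2 ^ n * N) (subdivision_iter A n delta_seq)"
  using mask_supp_iter[OF assms mask_supp_delta, where n = n]
  by (rule mask_supp_mono) auto

lemma pairing_iter:
  assumes A: "\<forall>k\<ge>1. mask_supp N (A k)" and c: "mask_supp L c"
  shows "pairing (subdivision_iter A n c) f =
    pairing c (\<lambda>\<beta>. pairing (subdivision_iter A n delta_seq) (\<lambda>\<gamma>. f (2 ^ n * \<beta> + \<gamma>)))"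
proof (induction n arbitrary: f)
  case 0 show ?case by simp
next
  case (Suc n)
  have step: "pairing (subdivision_iter A (Suc n) x) h =
     pairing (subdivision_iter A n x) (\<lambda>\<beta>. pairing (A (Suc n)) (\<lambda>\<gamma>. h (2 * \<beta> + \<gamma>)))"
    if "mask_supp L' x" for h x L'
    using pairing_subdivision[OF A[rule_format, of "Suc n"] mask_supp_iter[OF A that]] by simp
  show ?case
    unfolding step[OF c] step[OF mask_supp_delta] Suc
    by (simp add: algebra_simps)
qed

lemma subdivision_iter_add:
  "subdivision_iter A (k + n) c = subdivision_iter (\<lambda>i. A (k + i)) n (subdivision_iter A k c)"
  by (induction n) auto

text \<open>The adjoint formula tested against the indicator of \<alpha>, on both sides.\<close>

lemma subdivision_iter_pointwise:
  assumes A: "\<forall>k\<ge>1. mask_supp N (A k)" and c: "mask_supp L c"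
  shows "subdivision_iter A n c \<alpha> = pairing c (\<lambda>\<beta>. subdivision_iter A n delta_seq (\<alpha> - 2 ^ n * \<beta>))"
proof -
  have ind: "pairing x (\<lambda>\<gamma>. if \<gamma> = \<alpha> then 1 else 0) = x \<alpha>" if "mask_supp M x" for x \<alpha> M
    using mask_suppD[OF that, of \<alpha>] by (simp add: pairing_mask[OF that] if_distrib cong: if_cong)
  have "subdivision_iter A n c \<alpha> = pairing c (\<lambda>\<beta>. pairing (subdivision_iter A n delta_seq)
      (\<lambda>\<gamma>. if 2 ^ n * \<beta> + \<gamma> = \<alpha> then 1 else 0))"
    using pairing_iter[OF A c, where n = n and f = "\<lambda>\<gamma>. if \<gamma> = \<alpha> then 1 else 0"]
    by (simp add: ind[OF mask_supp_iter[OF A c]])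
  also have "\<dots> = pairing c (\<lambda>\<beta>. subdivision_iter A n delta_seq (\<alpha> - 2 ^ n * \<beta>))"
    by (intro pairing_cong)
      (simp add: ind[OF mask_supp_iter_delta[OF A], symmetric] eq_diff_eq algebra_simps)
  finally show ?thesis .
qed

section \<open>Limit functions and power boundedness\<close>

lemma pairing_add_left:
  assumes "mask_supp L c" "mask_supp L d"
  shows "pairing (\<lambda>\<alpha>. c \<alpha> + d \<alpha>) f = pairing c f + pairing d f"
proof -
  have "mask_supp L (\<lambda>\<alpha>. c \<alpha> + d \<alpha>)"
    using assms by (intro mask_suppI) (simp add: mask_suppD)
  then show ?thesis
    using assms by (simp add: pairing_mask ring_distribs sum.distrib)
qed

lemma subdivision_iter_plus:
  assumes A: "\<forall>k\<ge>1. mask_supp N (A k)" and c: "mask_supp L c" "mask_supp L d"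
  shows "subdivision_iter A n (\<lambda>\<alpha>. c \<alpha> + d \<alpha>) \<alpha> = subdivision_iter A n c \<alpha> + subdivision_iter A n d \<alpha>"
proof -
  have cd: "mask_supp L (\<lambda>\<alpha>. c \<alpha> + d \<alpha>)"
    using c by (intro mask_suppI) (simp add: mask_suppD)
  show ?thesis
    unfolding subdivision_iter_pointwise[OF A cd] subdivision_iter_pointwise[OF A c(1)]
      subdivision_iter_pointwise[OF A c(2)]
    by (rule pairing_add_left[OF c])
qed

text \<open>At a fixed index at most \<open>N + 1\<close> of the shifted responses to
  \<open>delta_seq\<close> are nonzero, so the constant depends neither on \<open>n\<close> nor on
  the length \<open>L\<close> of the data. This turns a bound for one sequence into power
  boundedness.\<close>

lemma subdivision_iter_bound:
  assumes A: "\<forall>k\<ge>1. mask_supp N (A k)" and c: "mask_supp L c"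
    and d: "\<And>\<alpha>. \<bar>subdivision_iter A n delta_seq \<alpha>\<bar> \<le> B" and b: "\<And>\<alpha>. \<bar>c \<alpha>\<bar> \<le> b"
  shows "\<bar>subdivision_iter A n c \<alpha>\<bar> \<le> (real N + 1) * B * b"
proof -
  define d where "d = subdivision_iter A n delta_seq"
  define W where "W = {\<alpha> div 2 ^ n - int N..\<alpha> div 2 ^ n}"
  have B: "0 \<le> B" "0 \<le> b"
    using d[of 0] b[of 0] by linarith+
  have z: "d (\<alpha> - 2 ^ n * \<beta>) = 0" if "\<beta> \<notin> W" for \<beta>
  proof -
    have "\<alpha> - 2 ^ n * \<beta> \<notin> {0..int (2 ^ n * N)}"
    proof
      assume *: "\<alpha> - 2 ^ n * \<beta> \<in> {0..int (2 ^ n * N)}"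
      define q r where "q = \<alpha> div 2 ^ n" and "r = \<alpha> mod 2 ^ n"
      have \<alpha>: "\<alpha> = 2 ^ n * q + r" "0 \<le> r" "r < 2 ^ n" by (auto simp: q_def r_def)
      have "2 ^ n * \<beta> < 2 ^ n * (q + 1)" using * \<alpha> by (auto simp: algebra_simps)
      then have 1: "\<beta> \<le> q" by simp
      have "2 ^ n * q \<le> 2 ^ n * (\<beta> + int N)" using * \<alpha> by (auto simp: algebra_simps)
      then have 2: "q \<le> \<beta> + int N" by simp
      from 1 2 that show False by (auto simp: W_def q_def)
    qed
    then show ?thesis
      unfolding d_def by (rule mask_suppD[OF mask_supp_iter_delta[OF A]])
  qed
  have "subdivision_iter A n c \<alpha> = (\<Sum>\<beta>\<in>{0..int L}. c \<beta> * d (\<alpha> - 2 ^ n * \<beta>))"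
    unfolding subdivision_iter_pointwise[OF A c] d_def by (rule pairing_mask[OF c])
  also have "\<dots> = (\<Sum>\<beta>\<in>W. c \<beta> * d (\<alpha> - 2 ^ n * \<beta>))"
    by (rule sum.mono_neutral_cong) (use z mask_suppD[OF c] in \<open>auto simp: W_def\<close>)
  also have "\<bar>\<dots>\<bar> \<le> (\<Sum>\<beta>\<in>W. \<bar>c \<beta> * d (\<alpha> - 2 ^ n * \<beta>)\<bar>)" by (rule sum_abs)
  also have "\<dots> \<le> (\<Sum>\<beta>\<in>W. b * B)"
    by (rule sum_mono) (use d b B in \<open>auto simp: abs_mult d_def intro!: mult_mono\<close>)
  also have "\<dots> = (real N + 1) * B * b" by (simp add: W_def)
  finally show ?thesis .
qed

lemma C_diff_imp_continuous:
  assumes "C_diff l g"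
  shows "continuous_on UNIV g"
proof (cases l)
  case 0 then show ?thesis using assms by (simp add: C_diff_def)
next
  case (Suc m)
  then have "g field_differentiable (at x)" for x
    using assms unfolding C_diff_def by (metis funpow_0 zero_less_Suc)
  then show ?thesis
    by (auto simp: continuous_on_eq_continuous_at field_differentiable_imp_continuous_at)
qed

lemma limit_function_eventually:
  assumes "limit_function l A c g" "e > 0"
  shows "\<forall>\<^sub>F k in sequentially. \<forall>\<alpha>. \<bar>g (of_int \<alpha> / 2 ^ k) - subdivision_iter A k c \<alpha>\<bar> \<le> e"
proof -
  have "\<forall>\<^sub>F k in sequentially. (SUP \<alpha>::int. ereal \<bar>g (of_int \<alpha> / 2 ^ k) - subdivision_iter A k c \<alpha>\<bar>) < ereal e"
    by (rule order_tendstoD(2)) (use assms in \<open>auto simp: limit_function_def\<close>)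
  then show ?thesis
  proof eventually_elim
    case (elim k)
    have "ereal \<bar>g (of_int \<alpha> / 2 ^ k) - subdivision_iter A k c \<alpha>\<bar> < ereal e" for \<alpha>
      by (rule le_less_trans[OF SUP_upper elim]) simp
    then show ?case by (auto intro: less_imp_le)
  qed
qed

lemma dyadic_floor_tendsto: "(\<lambda>k. of_int \<lfloor>2 ^ k * x\<rfloor> / 2 ^ k :: real) \<longlonglongrightarrow> x"
proof (rule LIMSEQ_I)
  fix r :: real assume "r > 0"
  then obtain m where m: "(1/2) ^ m < r"
    using real_arch_pow_inv[of r "1/2"] by auto
  have "norm (of_int \<lfloor>2 ^ k * x\<rfloor> / 2 ^ k - x) < r" if "k \<ge> m" for k
  proof -
    have *: "\<bar>real_of_int \<lfloor>2 ^ k * x\<rfloor> - 2 ^ k * x\<bar> \<le> 1" by linarith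
    have "real_of_int \<lfloor>2 ^ k * x\<rfloor> / 2 ^ k - x = (of_int \<lfloor>2 ^ k * x\<rfloor> - 2 ^ k * x) / 2 ^ k"
      by (simp add: diff_divide_distrib)
    with * have "\<bar>real_of_int \<lfloor>2 ^ k * x\<rfloor> / 2 ^ k - x\<bar> \<le> 1 / 2 ^ k"
      by (simp add: divide_right_mono)
    also have "\<dots> \<le> (1/2) ^ m"
      using that by (simp add: power_one_over divide_simps power_increasing)
    finally show ?thesis using m by simp
  qed
  then show "\<exists>no. \<forall>n\<ge>no. norm (of_int \<lfloor>2 ^ n * x\<rfloor> / 2 ^ n - x) < r" by blast
qed

text \<open>A point outside [0, N] is a limit of dyadic points that are eventually outside as well.
  There the iterates vanish exactly, and continuity forces the value 0.\<close>

lemma limit_function_support: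
  assumes A: "\<forall>k\<ge>1. mask_supp N (A k)" and g: "limit_function l A delta_seq g"
    and x: "x \<notin> {0..real N}"
  shows "g x = 0"
proof -
  define u where "u k = real_of_int \<lfloor>2 ^ k * x\<rfloor> / 2 ^ k" for k
  have u: "u \<longlonglongrightarrow> x" unfolding u_def by (rule dyadic_floor_tendsto)
  have "continuous_on UNIV g"
    using g C_diff_imp_continuous by (auto simp: limit_function_def)
  then have gu: "(\<lambda>k. g (u k)) \<longlonglongrightarrow> g x"
    using u by (auto simp: continuous_on_eq_continuous_at intro: isCont_tendsto_compose)
  have "open (- {0..real N})" by (intro open_Compl closed_atLeastAtMost)
  then have ev: "\<forall>\<^sub>F k in sequentially. u k \<in> - {0..real N}"
    using topological_tendstoD[OF u] x by blast
  have "\<bar>g x\<bar> \<le> e" if "e > 0" for e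
  proof (rule tendsto_upperbound[OF tendsto_rabs[OF gu]])
    show "\<forall>\<^sub>F k in sequentially. \<bar>g (u k)\<bar> \<le> e"
      using limit_function_eventually[OF g that] ev
    proof eventually_elim
      case (elim k)
      have "\<lfloor>2 ^ k * x\<rfloor> \<notin> {0..int (2 ^ k * N)}"
      proof
        assume "\<lfloor>2 ^ k * x\<rfloor> \<in> {0..int (2 ^ k * N)}"
        then have "real_of_int \<lfloor>2 ^ k * x\<rfloor> \<in> {0..real_of_int (int (2 ^ k * N))}"
          unfolding atLeastAtMost_iff of_int_le_iff of_int_0_le_iff .
        with elim(2) show False by (auto simp: u_def field_simps)
      qed
      then have "subdivision_iter A k delta_seq \<lfloor>2 ^ k * x\<rfloor> = 0"
        by (rule mask_suppD[OF mask_supp_iter_delta[OF A]])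
      with elim(1)[rule_format, of "\<lfloor>2 ^ k * x\<rfloor>"] show ?case by (simp add: u_def)
    qed
  qed simp
  then show ?thesis using field_le_epsilon[of "\<bar>g x\<bar>" 0] by simp
qed

lemma limit_function_bounded:
  assumes A: "\<forall>k\<ge>1. mask_supp N (A k)" and g: "limit_function l A delta_seq g"
  obtains B where "\<And>x. \<bar>g x\<bar> \<le> B"
proof -
  have "continuous_on {0..real N} g"
    using g C_diff_imp_continuous by (auto simp: limit_function_def intro: continuous_on_subset)
  then have "bounded (g ` {0..real N})"
    by (intro compact_imp_bounded compact_continuous_image) auto
  then obtain B where B: "\<And>x. x \<in> {0..real N} \<Longrightarrow> \<bar>g x\<bar> \<le> B"
    unfolding bounded_real by blast
  have "\<bar>g x\<bar> \<le> B" for x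
    using B[of x] B[of 0] limit_function_support[OF A g, of x] by (cases "x \<in> {0..real N}") auto
  then show ?thesis by (rule that)
qed

text \<open>Late iterates are within 1 of a bounded limit function, and the finitely many earlier
  ones have finite support.\<close>

lemma subdivision_iter_bounded:
  assumes A: "\<forall>k\<ge>1. mask_supp N (A k)" and g: "limit_function l A delta_seq g"
  obtains B where "B \<ge> 1" "\<And>n \<alpha>. \<bar>subdivision_iter A n delta_seq \<alpha>\<bar> \<le> B"
proof -
  obtain B1 where B1: "\<And>x. \<bar>g x\<bar> \<le> B1" using limit_function_bounded[OF A g] by blast
  obtain k0 where k0: "\<And>k \<alpha>. k \<ge> k0 \<Longrightarrow> \<bar>g (of_int \<alpha> / 2 ^ k) - subdivision_iter A k delta_seq \<alpha>\<bar> \<le> 1"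
    using limit_function_eventually[OF g, of 1] by (auto simp: eventually_sequentially)
  have "\<exists>B. \<forall>n<k. \<forall>\<alpha>. \<bar>subdivision_iter A n delta_seq \<alpha>\<bar> \<le> B" for k
  proof (induction k)
    case (Suc k)
    then obtain B where B: "\<And>n \<alpha>. n < k \<Longrightarrow> \<bar>subdivision_iter A n delta_seq \<alpha>\<bar> \<le> B" by blast
    let ?S = "{0..int (2 ^ k * N)}"
    let ?C = "\<Sum>\<alpha>\<in>?S. \<bar>subdivision_iter A k delta_seq \<alpha>\<bar>"
    have C: "\<bar>subdivision_iter A k delta_seq \<alpha>\<bar> \<le> ?C" for \<alpha>
    proof (cases "\<alpha> \<in> ?S")
      case True then show ?thesis by (intro member_le_sum) auto
    next
      case False
      then show ?thesis
        using mask_suppD[OF mask_supp_iter_delta[OF A] False] by (simp add: sum_nonneg)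
    qed
    have "\<bar>subdivision_iter A n delta_seq \<alpha>\<bar> \<le> max B ?C" if "n < Suc k" for n \<alpha>
      using B[of n \<alpha>] C[of \<alpha>] that by (cases "n = k") (auto simp: less_Suc_eq le_max_iff_disj)
    then show ?case by blast
  qed simp
  then obtain B0 where B0: "\<And>n \<alpha>. n < k0 \<Longrightarrow> \<bar>subdivision_iter A n delta_seq \<alpha>\<bar> \<le> B0" by blast
  have "\<bar>subdivision_iter A n delta_seq \<alpha>\<bar> \<le> max (max 1 B0) (B1 + 1)" for n \<alpha>
  proof (cases "n < k0")
    case True then show ?thesis using B0[OF True, of \<alpha>] by simp
  next
    case False then show ?thesis using k0[of n \<alpha>] B1[of "of_int \<alpha> / 2 ^ n"] by linarith
  qed
  then show ?thesis by (intro that[of "max (max 1 B0) (B1 + 1)"]) auto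
qed

section \<open>Growth of the iterates under perturbation of the masks\<close>

lemma subdivision_abs_le:
  assumes a: "mask_supp N a" and c: "mask_supp L c" and b: "\<And>\<alpha>. \<bar>c \<alpha>\<bar> \<le> b"
    and s: "(\<Sum>\<gamma>\<in>{0..int N}. \<bar>a \<gamma>\<bar>) \<le> s"
  shows "\<bar>subdivision a c \<alpha>\<bar> \<le> s * b"
proof -
  have b0: "0 \<le> b" using b[of 0] by linarith
  have "\<bar>subdivision a c \<alpha>\<bar> \<le> (\<Sum>\<beta>\<in>{0..int L}. \<bar>a (\<alpha> - 2 * \<beta>) * c \<beta>\<bar>)"
    unfolding subdivision_eq[OF c] by (rule sum_abs)
  also have "\<dots> \<le> (\<Sum>\<beta>\<in>{0..int L}. \<bar>a (\<alpha> - 2 * \<beta>)\<bar> * b)"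
    by (rule sum_mono) (use b in \<open>auto simp: abs_mult intro: mult_left_mono\<close>)
  also have "\<dots> = (\<Sum>\<gamma>\<in>(\<lambda>\<beta>. \<alpha> - 2 * \<beta>) ` {0..int L}. \<bar>a \<gamma>\<bar> * b)"
    by (simp add: sum.reindex inj_on_def)
  also have "\<dots> \<le> (\<Sum>\<gamma>\<in>{0..int N}. \<bar>a \<gamma>\<bar> * b)"
    by (rule order.trans[OF sum_mono2[of "(\<lambda>\<beta>. \<alpha> - 2 * \<beta>) ` {0..int L} \<union> {0..int N}"]
        eq_refl[OF sum.mono_neutral_right]])
      (use b0 mask_suppD[OF a] in auto)
  also have "\<dots> \<le> s * b" using s b0 by (simp add: sum_distrib_right[symmetric] mult_right_mono)
  finally show ?thesis .
qed

text \<open>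
  A discrete Gronwall argument: the induction over \<open>n\<close> closes because it controls the images of the
  perturbed iterate under all powers of the stationary operator at once.
\<close>

lemma perturbed_iter_growth:
  fixes a :: "int \<Rightarrow> real"
  assumes a: "mask_supp N a" and B: "\<forall>k\<ge>1. mask_supp N (B k)"
    and C1: "C \<ge> 1"
    and C: "\<And>c L b m \<alpha>. mask_supp L c \<Longrightarrow> (\<And>\<alpha>. \<bar>c \<alpha>\<bar> \<le> b) \<Longrightarrow>
               \<bar>subdivision_iter (\<lambda>_. a) m c \<alpha>\<bar> \<le> C * b"
    and \<epsilon>: "\<epsilon> \<ge> 0" "\<And>k. k \<ge> 1 \<Longrightarrow> (\<Sum>\<gamma>\<in>{0..int N}. \<bar>B k \<gamma> - a \<gamma>\<bar>) \<le> \<epsilon>"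
  shows "\<bar>subdivision_iter B n delta_seq \<alpha>\<bar> \<le> C * (1 + C * \<epsilon>) ^ n"
proof -
  have a': "\<forall>k\<ge>1. mask_supp N ((\<lambda>_::nat. a) k)" using a by simp
  have "\<bar>subdivision_iter (\<lambda>_. a) m (subdivision_iter B n delta_seq) \<alpha>\<bar> \<le> C * (1 + C * \<epsilon>) ^ n" for m \<alpha>
  proof (induction n arbitrary: m \<alpha>)
    case 0
    have "\<bar>delta_seq \<alpha>\<bar> \<le> 1" for \<alpha> by (simp add: delta_seq_def)
    from C[OF mask_supp_delta this] show ?case by simp
  next
    case (Suc n)
    let ?x = "subdivision_iter B n delta_seq"
    let ?\<rho> = "C * (1 + C * \<epsilon>) ^ n"
    define L where "L = 2 ^ n * N"
    have x: "mask_supp L ?x" unfolding L_def by (rule mask_supp_iter_delta[OF B])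
    let ?d = "\<lambda>\<gamma>. B (Suc n) \<gamma> - a \<gamma>"
    have d: "mask_supp N ?d" using a B[rule_format, of "Suc n"] by (intro mask_suppI) (simp add: mask_suppD)
    have split: "subdivision (B (Suc n)) ?x = (\<lambda>\<alpha>. subdivision a ?x \<alpha> + subdivision ?d ?x \<alpha>)"
      by (rule ext) (simp add: subdivision_eq[OF x] sum.distrib[symmetric] algebra_simps)
    have xb: "\<bar>?x \<alpha>\<bar> \<le> ?\<rho>" for \<alpha> using Suc[of 0 \<alpha>] by simp
    have "\<bar>subdivision_iter (\<lambda>_. a) m (subdivision ?d ?x) \<alpha>\<bar> \<le> C * (\<epsilon> * ?\<rho>)"
      by (rule C[OF mask_supp_subdivision[OF d x]]) (rule subdivision_abs_le[OF d x xb \<epsilon>(2)], simp)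
    \<comment> \<open>The unperturbed part is the induction hypothesis with one more stationary
      step, so it costs no factor \<open>C\<close>; only the defect does. Together they give
      \<open>?\<rho> * (1 + C * \<epsilon>)\<close>.\<close>
    moreover have "\<bar>subdivision_iter (\<lambda>_. a) m (subdivision a ?x) \<alpha>\<bar> \<le> ?\<rho>"
      using Suc[of "Suc m" \<alpha>] subdivision_iter_add[of "\<lambda>_. a" 1 m ?x] by simp
    moreover have "subdivision_iter (\<lambda>_. a) m (subdivision_iter B (Suc n) delta_seq) \<alpha>
       = subdivision_iter (\<lambda>_. a) m (subdivision a ?x) \<alpha> + subdivision_iter (\<lambda>_. a) m (subdivision ?d ?x) \<alpha>"
      unfolding subdivision_iter.simps split
      by (rule subdivision_iter_plus[OF a' mask_supp_subdivision[OF a x] mask_supp_subdivision[OF d x]])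
    ultimately show ?case by (simp add: algebra_simps)
  qed
  from this[of 0 \<alpha>] show ?thesis by simp
qed

section \<open>Finite differences\<close>

text \<open>Peels off the innermost derivative, so that inductions on \<open>l\<close> can pass from
  \<open>f\<close> to \<open>deriv f\<close>.\<close>

lemma C_diff_Suc: "C_diff (Suc l) f \<longleftrightarrow> (\<forall>x. f field_differentiable (at x)) \<and> C_diff l (deriv f)"
  unfolding C_diff_def All_less_Suc2 by (simp add: funpow_swap1)

lemma C_diff_SucD: "C_diff (Suc l) f \<Longrightarrow> C_diff l f"
proof (induction l arbitrary: f)
  case 0
  then show ?case using C_diff_imp_continuous[of "Suc 0" f] by (simp add: C_diff_def[of 0])
qed (use C_diff_Suc in blast)

lemma C_diff_const: "C_diff l (\<lambda>_. c)"
proof (induction l arbitrary: c)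
  case (Suc l)
  have "deriv (\<lambda>_::real. c) = (\<lambda>_. 0)" by (rule ext) simp
  then show ?case using Suc by (simp add: C_diff_Suc)
qed (simp add: C_diff_def)

lemma C_diff_ident: "C_diff l (\<lambda>x. x)"
proof (cases l)
  case (Suc m)
  have "deriv (\<lambda>x::real. x) = (\<lambda>_. 1)" by (rule ext) simp
  then show ?thesis using Suc by (simp add: C_diff_Suc C_diff_const)
qed (simp add: C_diff_def)

lemma C_diff_add: "C_diff l f \<Longrightarrow> C_diff l g \<Longrightarrow> C_diff l (\<lambda>x. f x + g x)"
proof (induction l arbitrary: f g)
  case (Suc l)
  have "deriv (\<lambda>x. f x + g x) = (\<lambda>x. deriv f x + deriv g x)"
    by (rule ext, rule deriv_add) (use Suc.prems in \<open>auto simp: C_diff_Suc\<close>)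
  then show ?case using Suc by (auto simp: C_diff_Suc intro: field_differentiable_add)
qed (auto simp: C_diff_def intro: continuous_intros)

lemma C_diff_mult: "C_diff l f \<Longrightarrow> C_diff l g \<Longrightarrow> C_diff l (\<lambda>x. f x * g x)"
proof (induction l arbitrary: f g)
  case (Suc l)
  have "deriv (\<lambda>x. f x * g x) = (\<lambda>x. f x * deriv g x + deriv f x * g x)"
    by (rule ext, rule deriv_mult) (use Suc.prems in \<open>auto simp: C_diff_Suc\<close>)
  moreover have "C_diff l (\<lambda>x. f x * deriv g x + deriv f x * g x)"
    using Suc.prems by (intro C_diff_add Suc.IH) (auto simp: C_diff_Suc intro: C_diff_SucD)
  ultimately show ?case using Suc.prems by (auto simp: C_diff_Suc intro: field_differentiable_mult)
qed (auto simp: C_diff_def intro: continuous_intros)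

lemma C_diff_power: "C_diff l (\<lambda>x. x ^ j)"
  by (induction j) (simp_all add: C_diff_const C_diff_mult C_diff_ident)

section \<open>Iterated forward differences\<close>

definition fdiff :: "real \<Rightarrow> (real \<Rightarrow> real) \<Rightarrow> real \<Rightarrow> real" where
  "fdiff h f x = f (x + h) - f x"

lemma fdiff_has_derivative:
  assumes "\<And>x. (f has_real_derivative f' x) (at x)"
  shows "((fdiff h ^^ l) f has_real_derivative (fdiff h ^^ l) f' x) (at x)"
proof (induction l arbitrary: x)
  case (Suc l)
  have "((\<lambda>x. (fdiff h ^^ l) f (x + h)) has_real_derivative (fdiff h ^^ l) f' (x + h)) (at x)"
    using Suc[of "x + h"] by (simp add: DERIV_shift)
  from DERIV_diff[OF this Suc[of x]] show ?case by (simp add: fdiff_def[abs_def])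
qed (use assms in simp)

text \<open>Differencing commutes with differentiation, so the mean value theorem trades one
  difference for a factor \<open>h\<close> and one derivative.\<close>

lemma fdiff_mean_value:
  assumes "C_diff l f" "h > 0"
  shows "\<exists>\<xi>\<ge>x. \<xi> \<le> x + real l * h \<and> (fdiff h ^^ l) f x = h ^ l * (deriv ^^ l) f \<xi>"
  using assms(1)
proof (induction l arbitrary: f x)
  case (Suc l)
  have "(f has_real_derivative deriv f x) (at x)" for x
    using Suc.prems by (simp add: C_diff_Suc DERIV_deriv_iff_field_differentiable)
  note D = fdiff_has_derivative[OF this]
  obtain z where z: "x < z" "z < x + h" "(fdiff h ^^ l) f (x + h) - (fdiff h ^^ l) f x = h * (fdiff h ^^ l) (deriv f) z"
    using MVT2[OF _ D, of x "x + h"] assms(2) by auto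
  obtain \<xi> where "\<xi> \<ge> z" "\<xi> \<le> z + real l * h" "(fdiff h ^^ l) (deriv f) z = h ^ l * (deriv ^^ l) (deriv f) \<xi>"
    using Suc.IH[of "deriv f" z] Suc.prems by (auto simp: C_diff_Suc)
  moreover have "(fdiff h ^^ Suc l) f x = (fdiff h ^^ l) f (x + h) - (fdiff h ^^ l) f x"
    by (simp add: fdiff_def)
  moreover have "(deriv ^^ Suc l) f = (deriv ^^ l) (deriv f)" by (simp add: funpow_swap1)
  ultimately show ?case using z
    by (intro exI[of _ \<xi>]) (auto simp: algebra_simps)
qed auto

text \<open>Forward differences look to the right, so the support grows only to the left, by
  \<open>h\<close> each time.\<close>

lemma fdiff_support:
  assumes "\<And>x. x \<notin> {-L..L} \<Longrightarrow> f x = 0" "h \<ge> 0" "x \<notin> {- L - real p * h..L}"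
  shows "(fdiff h ^^ p) f x = 0"
  using assms(3)
proof (induction p arbitrary: x)
  case (Suc p)
  have "x + h \<notin> {- L - real p * h..L}" "x \<notin> {- L - real p * h..L}"
    using Suc.prems assms(2) by (auto simp: algebra_simps)
  then show ?case using Suc.IH by (simp add: fdiff_def)
qed (use assms(1) in auto)

text \<open>The differences of order \<open>l\<close> at x and x + h are h^l times values of the
  l-th derivative at points at most (l + 1) h apart. Uniform continuity of that derivative makes the
  last difference small.\<close>

lemma fdiff_small:
  assumes f: "C_diff l f" and supp: "\<And>x. x \<notin> {-L..L} \<Longrightarrow> f x = 0" and "\<epsilon> > 0"
  obtains \<delta> where "\<delta> > 0" "\<And>h x. 0 < h \<Longrightarrow> h < \<delta> \<Longrightarrow> \<bar>(fdiff h ^^ Suc l) f x\<bar> \<le> \<epsilon> * h ^ l"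
proof -
  let ?p = "real (Suc l)"
  let ?K = "{- L - ?p..L + ?p}"
  have "uniformly_continuous_on ?K ((deriv ^^ l) f)"
    using f by (intro compact_uniformly_continuous) (auto simp: C_diff_def intro: continuous_on_subset)
  then obtain \<delta> where \<delta>: "\<delta> > 0" "\<And>x y. x \<in> ?K \<Longrightarrow> y \<in> ?K \<Longrightarrow> dist y x < \<delta> \<Longrightarrow>
      dist ((deriv ^^ l) f y) ((deriv ^^ l) f x) < \<epsilon>"
    using \<open>\<epsilon> > 0\<close> unfolding uniformly_continuous_on_def by meson
  \<comment> \<open>The bound 1 on \<open>h\<close> keeps both intermediate points inside
    \<open>?K\<close>; the other bound makes (l + 1) h less than \<delta>.\<close>
  show ?thesis
  proof (rule that[of "min 1 (\<delta> / (?p + 1))"])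
    fix h x :: real
    assume h: "0 < h" "h < min 1 (\<delta> / (?p + 1))"
    then have h': "h < 1" "?p * h < \<delta>" by (auto simp: field_simps)
    have pl: "real l * h \<le> real l" "?p * h \<le> ?p" using h by (auto simp: mult_left_le)
    show "\<bar>(fdiff h ^^ Suc l) f x\<bar> \<le> \<epsilon> * h ^ l"
    proof (cases "x \<in> {- L - ?p * h..L}")
      case False
      then have "(fdiff h ^^ Suc l) f x = 0" using fdiff_support[OF supp _ False] h by simp
      then show ?thesis using \<open>\<epsilon> > 0\<close> h by simp
    next
      case True
      obtain \<xi> where \<xi>: "\<xi> \<ge> x" "\<xi> \<le> x + real l * h" "(fdiff h ^^ l) f x = h ^ l * (deriv ^^ l) f \<xi>"
        using fdiff_mean_value[OF f h(1)] by blast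
      obtain \<zeta> where \<zeta>: "\<zeta> \<ge> x + h" "\<zeta> \<le> x + h + real l * h" "(fdiff h ^^ l) f (x + h) = h ^ l * (deriv ^^ l) f \<zeta>"
        using fdiff_mean_value[OF f h(1)] by blast
      have ph: "?p * h = h + real l * h" by (simp add: algebra_simps)
      have "\<xi> \<in> ?K" "\<zeta> \<in> ?K" "dist \<zeta> \<xi> < \<delta>"
        using \<xi> \<zeta> True h h' pl ph by (auto simp: dist_real_def)
      then have "\<bar>(deriv ^^ l) f \<zeta> - (deriv ^^ l) f \<xi>\<bar> < \<epsilon>" using \<delta>(2) by (auto simp: dist_real_def)
      moreover have "(fdiff h ^^ Suc l) f x = h ^ l * ((deriv ^^ l) f \<zeta> - (deriv ^^ l) f \<xi>)"
        using \<xi> \<zeta> by (simp add: fdiff_def right_diff_distrib)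
      ultimately show ?thesis using h by (simp add: abs_mult mult.commute mult_left_mono)
    qed
  qed (use \<delta> in auto)
qed

text \<open>Summation by parts: the shift passes to the weight and only changes its sign, so both
  terms of the difference contribute the same amount.\<close>

lemma pairing_difference_antiperiodic:
  fixes s :: int
  assumes c: "finite {\<gamma>. c \<gamma> \<noteq> 0}" and u: "\<And>\<gamma>. u (\<gamma> + s) = - u \<gamma>"
  shows "pairing (\<lambda>\<gamma>. c (\<gamma> + s) - c \<gamma>) u = - 2 * pairing c u"
proof -
  let ?S = "{\<gamma>. c \<gamma> \<noteq> 0}"
  let ?S' = "(\<lambda>\<gamma>. \<gamma> - s) ` ?S"
  have S': "c (\<gamma> + s) = 0" if "\<gamma> \<notin> ?S'" for \<gamma>
    using that by (auto simp: image_iff dest: spec[of _ "\<gamma> + s"])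
  have fin: "finite (?S \<union> ?S')" using c by simp
  have "u (\<gamma> - s) = - u \<gamma>" for \<gamma> using u[of "\<gamma> - s"] by simp
  then have "pairing (\<lambda>\<gamma>. c (\<gamma> + s)) u = - pairing c u"
    unfolding pairing_shift[OF c] by (simp add: pairing_def sum_negf)
  moreover have "pairing (\<lambda>\<gamma>. c (\<gamma> + s) - c \<gamma>) u = pairing (\<lambda>\<gamma>. c (\<gamma> + s)) u - pairing c u"
  proof -
    have "pairing (\<lambda>\<gamma>. c (\<gamma> + s) - c \<gamma>) u = (\<Sum>\<gamma>\<in>?S \<union> ?S'. (c (\<gamma> + s) - c \<gamma>) * u \<gamma>)"
      by (rule pairing_superset[OF fin]) (use S' in auto)
    moreover have "pairing (\<lambda>\<gamma>. c (\<gamma> + s)) u = (\<Sum>\<gamma>\<in>?S \<union> ?S'. c (\<gamma> + s) * u \<gamma>)"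
      by (rule pairing_superset[OF fin]) (use S' in auto)
    moreover have "pairing c u = (\<Sum>\<gamma>\<in>?S \<union> ?S'. c \<gamma> * u \<gamma>)"
      by (rule pairing_superset[OF fin]) auto
    ultimately show ?thesis by (simp add: sum_subtractf left_diff_distrib)
  qed
  ultimately show ?thesis by simp
qed

text \<open>The difference step is \<open>s\<close> times the sampling mesh \<open>h'\<close>, so on
  the grid each difference is a shift of the index by \<open>s\<close>. Compact support is needed
  anew at each order to have finite sums to shift.\<close>

lemma pairing_fdiff_antiperiodic:
  fixes s :: int
  assumes supp: "\<And>x. x \<notin> {-L..L} \<Longrightarrow> F x = 0" and h: "h' > 0" "s \<ge> 0"
    and u: "\<And>\<gamma>. u (\<gamma> + s) = - u \<gamma>"
  shows "pairing (\<lambda>\<gamma>. (fdiff (of_int s * h') ^^ p) F (of_int \<gamma> * h')) u = (- 2) ^ p * pairing (\<lambda>\<gamma>. F (of_int \<gamma> * h')) u"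
proof (induction p)
  case (Suc p)
  let ?G = "(fdiff (of_int s * h') ^^ p) F"
  let ?M = "\<bar>L\<bar> + real p * (of_int s * h')"
  have "\<gamma> \<in> {\<lfloor>- ?M / h'\<rfloor>..\<lceil>?M / h'\<rceil>}" if "?G (of_int \<gamma> * h') \<noteq> 0" for \<gamma>
  proof -
    have "of_int \<gamma> * h' \<in> {- L - real p * (of_int s * h')..L}"
    proof (rule ccontr)
      assume "of_int \<gamma> * h' \<notin> {- L - real p * (of_int s * h')..L}"
      then have "?G (of_int \<gamma> * h') = 0" using supp h by (intro fdiff_support) auto
      with that show False ..
    qed
    moreover have "0 \<le> real p * (of_int s * h')" using h by simp
    ultimately have "- ?M \<le> of_int \<gamma> * h'" "of_int \<gamma> * h' \<le> ?M" by auto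
    then have "- ?M / h' \<le> of_int \<gamma>" "of_int \<gamma> \<le> ?M / h'" using h(1) by (simp_all add: field_simps)
    then show ?thesis unfolding atLeastAtMost_iff floor_le_iff le_ceiling_iff by linarith
  qed
  then have "{\<gamma>. ?G (of_int \<gamma> * h') \<noteq> 0} \<subseteq> {\<lfloor>- ?M / h'\<rfloor>..\<lceil>?M / h'\<rceil>}" by blast
  then have fin: "finite {\<gamma>. ?G (of_int \<gamma> * h') \<noteq> 0}" by (rule finite_subset) simp
  from pairing_difference_antiperiodic[where u = u, OF fin u]
  show ?case by (simp add: Suc fdiff_def[of _ ?G] ring_distribs)
qed simp

text \<open>
  Against an antiperiodic weight of half-period \<open>h\<close>, a sum is reproduced up to the factor \<open>- 1 / 2\<close> when
  the summand is replaced by its difference of step \<open>h\<close>; this plays the role of the Riemann-Lebesgue lemma.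
\<close>

lemma oscillating_sum_small:
  assumes F: "C_diff l F" and supp: "\<And>x. x \<notin> {-L..L} \<Longrightarrow> F x = 0" and L: "L \<ge> 0" and "\<epsilon> > 0"
    and w: "\<And>x::real. w (x + 1) = - w x" "\<And>x. \<bar>w x\<bar> \<le> (2::real)"
  shows "\<forall>\<^sub>F k in sequentially. \<forall>n.
    \<bar>pairing (\<lambda>\<gamma>. F (of_int \<gamma> / 2 ^ (k + n))) (\<lambda>\<gamma>. w (of_int \<gamma> / 2 ^ n))\<bar> / 2 ^ (k + n) \<le> \<epsilon> / 2 ^ (l * k)"
proof -
  let ?p = "real (Suc l)"
  \<comment> \<open>The support of the difference of order l + 1 has length at most 2 L + (l + 1) h,
    so it meets at most q / h' grid points. The 2 in the next definition is the bound on
    \<open>w\<close>.\<close>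
  define q where "q = 2 * L + ?p + 1"
  define \<epsilon>' where "\<epsilon>' = \<epsilon> / (2 * q)"
  have q: "q > 0" using L by (simp add: q_def)
  then have "\<epsilon>' > 0" using \<open>\<epsilon> > 0\<close> by (simp add: \<epsilon>'_def)
  then obtain \<delta> where \<delta>: "\<delta> > 0" "\<And>h x. 0 < h \<Longrightarrow> h < \<delta> \<Longrightarrow> \<bar>(fdiff h ^^ Suc l) F x\<bar> \<le> \<epsilon>' * h ^ l"
    using fdiff_small[OF F supp] by metis
  have "(\<lambda>n. (1/2 :: real) ^ n) \<longlonglongrightarrow> 0" by (rule LIMSEQ_power_zero) simp
  then have "\<forall>\<^sub>F k in sequentially. (1/2) ^ k < \<delta>" by (rule order_tendstoD) (use \<delta> in simp)
  then show ?thesis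
  proof eventually_elim
    case (elim k)
    show ?case
    proof
      fix n
      define h h' :: real where "h = (1/2) ^ k" and "h' = (1/2) ^ (k + n)"
      have h: "0 < h" "h \<le> 1" "h < \<delta>" "0 < h'" "h' \<le> 1" "of_int (2 ^ n) * h' = h"
        using elim by (simp_all add: h_def h'_def power_le_one) (simp add: power_add power_one_over)

      let ?u = "\<lambda>\<gamma>::int. w (of_int \<gamma> / 2 ^ n)"
      let ?G = "\<lambda>\<gamma>::int. (fdiff h ^^ Suc l) F (of_int \<gamma> * h')"
      let ?S = "{\<lceil>(- L - ?p * h) / h'\<rceil>..\<lfloor>L / h'\<rfloor>}"
      have G0: "?G \<gamma> = 0" if "\<gamma> \<notin> ?S" for \<gamma>
      proof (rule fdiff_support[OF supp])
        show "of_int \<gamma> * h' \<notin> {- L - ?p * h..L}"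
        proof
          assume "of_int \<gamma> * h' \<in> {- L - ?p * h..L}"
          then have "(- L - ?p * h) / h' \<le> of_int \<gamma>" "of_int \<gamma> \<le> L / h'"
            using h(4) by (simp_all add: pos_divide_le_eq pos_le_divide_eq)
          then have "\<gamma> \<in> ?S" by (simp add: ceiling_le_iff le_floor_iff)
          with that show False ..
        qed
      qed (use h in auto)
      have "\<bar>pairing ?G ?u\<bar> = \<bar>\<Sum>\<gamma>\<in>?S. ?G \<gamma> * ?u \<gamma>\<bar>"
        by (subst pairing_superset[of ?S]) (use G0 in auto)
      also have "\<dots> \<le> (\<Sum>\<gamma>\<in>?S. (\<epsilon>' * h ^ l) * 2)"
        by (rule order.trans[OF sum_abs sum_mono], unfold abs_mult, intro mult_mono \<delta>(2) w(2))
          (use h \<open>\<epsilon>' > 0\<close> in auto)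
      also have "\<dots> = real (card ?S) * (\<epsilon>' * h ^ l * 2)" by simp
      also have "\<dots> \<le> (q / h') * (\<epsilon>' * h ^ l * 2)"
      proof (intro mult_right_mono)
        have "L / h' - (- L - ?p * h) / h' + 1 = (2 * L + ?p * h + h') / h'"
          using h(4) by (simp add: field_simps)
        also have "\<dots> \<le> q / h'"
          unfolding q_def using h by (intro divide_right_mono add_mono mult_left_le) auto
        finally have "L / h' - (- L - ?p * h) / h' + 1 \<le> q / h'" .
        moreover have "0 \<le> q / h'" using q h by simp
        ultimately show "real (card ?S) \<le> q / h'"
          unfolding card_atLeastAtMost_int by linarith
      qed (use h \<open>\<epsilon>' > 0\<close> in auto)
      also have "\<dots> = \<epsilon> * h ^ l / h'" using q by (simp add: \<epsilon>'_def field_simps)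
      finally have 1: "\<bar>pairing ?G ?u\<bar> \<le> \<epsilon> * h ^ l / h'" .
      \<comment> \<open>A shift by 2^n fine indices advances the argument of \<open>w\<close> by 1,
        whatever \<open>n\<close> is; this fixes the difference step at \<open>h\<close>.\<close>
      have u: "?u (\<gamma> + 2 ^ n) = - ?u \<gamma>" for \<gamma>
        using w(1)[of "real_of_int \<gamma> / 2 ^ n"] by (simp add: add_divide_distrib)
      have "pairing ?G ?u = (- 2) ^ Suc l * pairing (\<lambda>\<gamma>. F (of_int \<gamma> * h')) ?u"
        using pairing_fdiff_antiperiodic[of L F h' "2 ^ n" ?u "Suc l", OF supp h(4) _ u] h(6) by simp
      then have "\<bar>pairing ?G ?u\<bar> = 2 ^ Suc l * \<bar>pairing (\<lambda>\<gamma>. F (of_int \<gamma> * h')) ?u\<bar>"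
        by (simp add: abs_mult power_abs)
      \<comment> \<open>The factor gained by differencing exceeds 1 in modulus and can simply be
        dropped.\<close>
      moreover have "1 * \<bar>pairing (\<lambda>\<gamma>. F (of_int \<gamma> * h')) ?u\<bar> \<le> 2 ^ Suc l * \<bar>pairing (\<lambda>\<gamma>. F (of_int \<gamma> * h')) ?u\<bar>"
        by (intro mult_right_mono one_le_power) auto
      ultimately have "\<bar>pairing (\<lambda>\<gamma>. F (of_int \<gamma> * h')) ?u\<bar> \<le> \<bar>pairing ?G ?u\<bar>" by simp
      then have "\<bar>pairing (\<lambda>\<gamma>. F (of_int \<gamma> * h')) ?u\<bar> \<le> \<epsilon> * h ^ l / h'" using 1 by (rule order.trans)
      then have "\<bar>pairing (\<lambda>\<gamma>. F (of_int \<gamma> * h')) ?u\<bar> * h' \<le> \<epsilon> * h ^ l"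
        using h(4) by (simp add: pos_le_divide_eq)
      then show "\<bar>pairing (\<lambda>\<gamma>. F (of_int \<gamma> / 2 ^ (k + n))) ?u\<bar> / 2 ^ (k + n) \<le> \<epsilon> / 2 ^ (l * k)"
        by (simp add: h_def h'_def power_one_over power_mult[symmetric] mult.commute)
    qed
  qed
qed

section \<open>Asymptotic masks\<close>

lemma pairing_abs_le_sum:
  assumes a: "mask_supp N a" and s: "(\<Sum>\<gamma>\<in>{0..int N}. \<bar>a \<gamma>\<bar>) \<le> s"
    and f: "\<And>\<gamma>. 0 \<le> \<gamma> \<Longrightarrow> \<gamma> \<le> int N \<Longrightarrow> \<bar>f \<gamma>\<bar> \<le> r"
  shows "\<bar>pairing a f\<bar> \<le> s * r"
proof -
  have r: "0 \<le> r" using f[of 0] by (auto intro: order.trans[OF abs_ge_zero])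
  have "\<bar>pairing a f\<bar> \<le> (\<Sum>\<gamma>\<in>{0..int N}. \<bar>a \<gamma> * f \<gamma>\<bar>)"
    unfolding pairing_mask[OF a] by (rule sum_abs)
  also have "\<dots> \<le> (\<Sum>\<gamma>\<in>{0..int N}. \<bar>a \<gamma>\<bar> * r)"
    by (rule sum_mono) (use f in \<open>auto simp: abs_mult intro: mult_left_mono\<close>)
  also have "\<dots> \<le> s * r" using s r by (simp add: sum_distrib_right[symmetric] mult_right_mono)
  finally show ?thesis .
qed

section \<open>Dyadic sums and their uniform convergence for tails of the scheme\<close>

definition dyadic_pairing :: "(nat \<Rightarrow> int \<Rightarrow> real) \<Rightarrow> nat \<Rightarrow> (real \<Rightarrow> real) \<Rightarrow> real" where
  "dyadic_pairing A n f = pairing (subdivision_iter A n delta_seq) (\<lambda>\<gamma>. f (of_int \<gamma> / 2 ^ n)) / 2 ^ n"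

text \<open>A mask of sum 2 only redistributes mass over points at distance at most N / 2^(n + 1),
  which a Lipschitz function hardly notices. There are at most 2^n (N + 1) terms, and this count
  cancels against the normalisation, leaving one factor 2^-n.\<close>

lemma dyadic_pairing_step:
  assumes B: "\<forall>k\<ge>1. mask_supp N (B k)" "\<forall>k\<ge>1. pairing (B k) (\<lambda>_. 1) = 2"
    and s: "\<forall>k\<ge>1. (\<Sum>\<gamma>\<in>{0..int N}. \<bar>B k \<gamma>\<bar>) \<le> s"
    and C: "\<And>\<alpha>. \<bar>subdivision_iter B n delta_seq \<alpha>\<bar> \<le> C"
    and f: "\<Lambda>-lipschitz_on {0..2 * real N} f"
  shows "\<bar>dyadic_pairing B (Suc n) f - dyadic_pairing B n f\<bar> \<le> (real N + 1) * s * \<Lambda> * real N / 4 * (C / 2 ^ n)"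
proof -
  let ?x = "subdivision_iter B n delta_seq"
  let ?b = "B (Suc n)"
  have x: "mask_supp (2 ^ n * N) ?x" by (rule mask_supp_iter_delta[OF B(1)])
  have b: "mask_supp N ?b" "pairing ?b (\<lambda>_. 1) = 2" "(\<Sum>\<gamma>\<in>{0..int N}. \<bar>?b \<gamma>\<bar>) \<le> s"
    using B s by auto
  have \<Lambda>: "\<Lambda> \<ge> 0" using f lipschitz_on_nonneg by blast
  have C0: "C \<ge> 0" using C[of 0] by linarith
  have s0: "s \<ge> 0" by (rule order.trans[OF sum_nonneg b(3)]) simp
  define F where "F \<beta> \<gamma> = f ((2 * of_int \<beta> + of_int \<gamma>) / (2 * 2 ^ n)) - f (of_int \<beta> / 2 ^ n)" for \<beta> \<gamma> :: int
  have F: "\<bar>F \<beta> \<gamma>\<bar> \<le> \<Lambda> * (real N / (2 * 2 ^ n))"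
    if "0 \<le> \<beta>" "\<beta> \<le> int (2 ^ n * N)" "0 \<le> \<gamma>" "\<gamma> \<le> int N" for \<beta> \<gamma>
  proof -
    have "real_of_int \<beta> \<le> real_of_int (int (2 ^ n * N))" using that by linarith
    then have \<beta>: "real_of_int \<beta> \<le> real N * 2 ^ n" "real_of_int \<gamma> \<le> N"
      using that by (auto simp: mult.commute)
    have le: "real N \<le> real N * 2 ^ n" by (simp add: mult_le_cancel_left1)
    \<comment> \<open>With \<beta> / 2^n up to N and \<gamma> up to N, the refined point can reach 3
      N / 2; hence the Lipschitz condition beyond [0, N].\<close>
    have "dist (f ((2 * of_int \<beta> + of_int \<gamma>) / (2 * 2 ^ n))) (f (of_int \<beta> / 2 ^ n))
      \<le> \<Lambda> * dist ((2 * of_int \<beta> + of_int \<gamma>) / (2 * 2 ^ n)) (real_of_int \<beta> / 2 ^ n)"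
      by (rule lipschitz_onD[OF f]) (use that \<beta> le in \<open>auto simp: divide_simps mult.assoc\<close>)
    also have "dist ((2 * of_int \<beta> + of_int \<gamma>) / (2 * 2 ^ n)) (real_of_int \<beta> / 2 ^ n) = real_of_int \<gamma> / (2 * 2 ^ n)"
      using that by (simp add: dist_real_def add_divide_distrib)
    also have "\<Lambda> * (real_of_int \<gamma> / (2 * 2 ^ n)) \<le> \<Lambda> * (real N / (2 * 2 ^ n))"
      using \<beta> \<Lambda> by (intro mult_left_mono divide_right_mono) auto
    finally show ?thesis by (simp add: F_def dist_real_def)
  qed
  have "pairing (subdivision_iter B (Suc n) delta_seq) (\<lambda>\<gamma>. f (of_int \<gamma> / 2 ^ Suc n))
      = pairing ?x (\<lambda>\<beta>. pairing ?b (\<lambda>\<gamma>. f ((2 * of_int \<beta> + of_int \<gamma>) / (2 * 2 ^ n))))"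
    using pairing_subdivision[OF b(1) x] by simp
  \<comment> \<open>The mask sum 2 matches the ratio of the two normalisations, so the values of
    \<open>f\<close> at the coarse points cancel.\<close>
  moreover have "2 * pairing ?x (\<lambda>\<beta>. f (of_int \<beta> / 2 ^ n)) = pairing ?x (\<lambda>\<beta>. pairing ?b (\<lambda>\<gamma>. f (of_int \<beta> / 2 ^ n)))"
    using pairing_scale[of ?b _ "\<lambda>_. 1"] by (simp add: b(2) pairing_scale_right)
  ultimately have "dyadic_pairing B (Suc n) f - dyadic_pairing B n f = pairing ?x (\<lambda>\<beta>. pairing ?b (F \<beta>)) / (2 * 2 ^ n)"
    unfolding dyadic_pairing_def F_def by (simp add: pairing_diff field_simps)
  also have "\<bar>\<dots>\<bar> \<le> ((real (2 ^ n * N) + 1) * (C * (s * (\<Lambda> * (real N / (2 * 2 ^ n)))))) / \<bar>2 * 2 ^ n\<bar>"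
    unfolding abs_divide
    by (intro divide_right_mono pairing_abs_le[OF x C] pairing_abs_le_sum[OF b(1,3)] F) auto
  also have "\<dots> \<le> (2 ^ n * (real N + 1) * (C * (s * (\<Lambda> * (real N / (2 * 2 ^ n)))))) / (2 * 2 ^ n)"
    unfolding abs_of_pos[OF mult_pos_pos[OF zero_less_numeral zero_less_power[OF zero_less_numeral]]]
    by (intro divide_right_mono mult_right_mono) (use C0 s0 \<Lambda> in \<open>auto simp: algebra_simps\<close>)
  also have "\<dots> = (real N + 1) * s * \<Lambda> * real N / 4 * (C / 2 ^ n)"
    by (simp add: field_simps)
  finally show ?thesis .
qed

locale asymptotic_masks =
  fixes N :: nat and a :: "int \<Rightarrow> real" and A :: "nat \<Rightarrow> int \<Rightarrow> real" and \<phi> :: "real \<Rightarrow> real"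
  assumes mask_a: "mask_supp N a"
    and mask_A: "\<forall>k\<ge>1. mask_supp N (A k)"
    and sum_A: "\<forall>k\<ge>1. pairing (A k) (\<lambda>_. 1) = 2"
    and A_tendsto: "\<And>\<alpha>. (\<lambda>k. A k \<alpha>) \<longlonglongrightarrow> a \<alpha>"
    and limit_\<phi>: "limit_function 0 (\<lambda>_. a) delta_seq \<phi>"
begin

lemma masks_a: "\<forall>k\<ge>1. mask_supp N ((\<lambda>_. a) k)"
  using mask_a by simp

abbreviation tail :: "nat \<Rightarrow> nat \<Rightarrow> int \<Rightarrow> real" where
  "tail k \<equiv> (\<lambda>i. A (k + i))"

lemma mask_tail: "\<forall>i\<ge>1. mask_supp N (tail k i)"
  using mask_A by simp

text \<open>Power boundedness of the stationary operator: the iterates of \<open>delta_seq\<close>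
  are uniformly bounded and at most \<open>N + 1\<close> of their shifts overlap.\<close>

lemma stationary_bound:
  obtains C where "C \<ge> 1" "\<And>c L b m \<alpha>. mask_supp L c \<Longrightarrow> (\<And>\<alpha>. \<bar>c \<alpha>\<bar> \<le> b) \<Longrightarrow>
               \<bar>subdivision_iter (\<lambda>_. a) m c \<alpha>\<bar> \<le> C * b"
proof -
  obtain B where B: "B \<ge> 1" "\<And>n \<alpha>. \<bar>subdivision_iter (\<lambda>_. a) n delta_seq \<alpha>\<bar> \<le> B"
    using subdivision_iter_bounded[OF masks_a limit_\<phi>] by blast
  show ?thesis
    by (rule that[of "(real N + 1) * B"])
      (use B mult_mono[of 1 "real N + 1" 1 B] subdivision_iter_bound[OF masks_a] in auto)
qed

lemma eventually_tail_close:
  assumes "\<epsilon> > 0"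
  shows "\<forall>\<^sub>F k in sequentially. \<forall>i. (\<Sum>\<gamma>\<in>{0..int N}. \<bar>A (k + i) \<gamma> - a \<gamma>\<bar>) \<le> \<epsilon>"
proof -
  have "(\<lambda>k. \<Sum>\<gamma>\<in>{0..int N}. \<bar>A k \<gamma> - a \<gamma>\<bar>) \<longlonglongrightarrow> (\<Sum>\<gamma>\<in>{0..int N}. \<bar>a \<gamma> - a \<gamma>\<bar>)"
    by (intro tendsto_intros A_tendsto)
  then have "\<forall>\<^sub>F k in sequentially. (\<Sum>\<gamma>\<in>{0..int N}. \<bar>A k \<gamma> - a \<gamma>\<bar>) < \<epsilon>"
    by (rule order_tendstoD) (use assms in simp)
  then obtain K where K: "\<And>k. k \<ge> K \<Longrightarrow> (\<Sum>\<gamma>\<in>{0..int N}. \<bar>A k \<gamma> - a \<gamma>\<bar>) < \<epsilon>"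
    by (auto simp: eventually_sequentially)
  have "\<forall>i. (\<Sum>\<gamma>\<in>{0..int N}. \<bar>A (k + i) \<gamma> - a \<gamma>\<bar>) \<le> \<epsilon>" if "k \<ge> K" for k
    using K[of "k + _"] that by (auto intro!: less_imp_le)
  then show ?thesis unfolding eventually_sequentially by blast
qed

text \<open>Once the masks are close to \<open>a\<close>, the iterates of the tail grow no faster
  than (3/2)^n, while one step of the dyadic sum gains 2^-n. The product (3/4)^n is summable with a
  constant that is the same for all large k.\<close>

lemma dyadic_pairing_tail_Cauchy:
  assumes f: "\<Lambda>-lipschitz_on {0..2 * real N} f"
  obtains D where "\<forall>\<^sub>F k in sequentially. \<forall>n m.
    \<bar>dyadic_pairing (tail k) (n + m) f - dyadic_pairing (tail k) n f\<bar> \<le> D * (3 / 4) ^ n"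
proof -
  obtain C where C: "C \<ge> 1" "\<And>c L b m \<alpha>. mask_supp L c \<Longrightarrow> (\<And>\<alpha>. \<bar>c \<alpha>\<bar> \<le> b) \<Longrightarrow>
               \<bar>subdivision_iter (\<lambda>_. a) m c \<alpha>\<bar> \<le> C * b"
    using stationary_bound by blast
  define s where "s = (\<Sum>\<gamma>\<in>{0..int N}. \<bar>a \<gamma>\<bar>) + 1 / (2 * C)"
  define D where "D = (real N + 1) * s * \<Lambda> * real N / 4 * C"
  have s: "s \<ge> 0" using C(1) by (auto simp: s_def intro!: add_nonneg_nonneg sum_nonneg)
  have D: "D \<ge> 0" using s C(1) lipschitz_on_nonneg[OF f] by (simp add: D_def)
  \<comment> \<open>This closeness of the masks turns the growth factor 1 + C \<epsilon> into
    3/2.\<close>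
  have \<epsilon>: "1 / (2 * C) > 0" using C(1) by simp
  have "\<forall>\<^sub>F k in sequentially. \<forall>n m.
    \<bar>dyadic_pairing (tail k) (n + m) f - dyadic_pairing (tail k) n f\<bar> \<le> (4 * D) * (3 / 4) ^ n"
    using eventually_tail_close[OF \<epsilon>]
  proof eventually_elim
    case (elim k)
    have growth: "\<bar>subdivision_iter (tail k) n delta_seq \<alpha>\<bar> \<le> C * (3 / 2) ^ n" for n \<alpha>
    proof -
      have "\<bar>subdivision_iter (tail k) n delta_seq \<alpha>\<bar> \<le> C * (1 + C * (1 / (2 * C))) ^ n"
        by (rule perturbed_iter_growth[OF mask_a mask_tail C less_imp_le[OF \<epsilon>]]) (use elim in auto)
      then show ?thesis using C(1) by simp
    qed
    have "(\<Sum>\<gamma>\<in>{0..int N}. \<bar>A (k + i) \<gamma>\<bar>) \<le> s" for i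
    proof -
      have "(\<Sum>\<gamma>\<in>{0..int N}. \<bar>A (k + i) \<gamma>\<bar>) \<le> (\<Sum>\<gamma>\<in>{0..int N}. \<bar>a \<gamma>\<bar> + \<bar>A (k + i) \<gamma> - a \<gamma>\<bar>)"
        by (rule sum_mono) linarith
      then show ?thesis using elim[rule_format, of i] by (simp add: sum.distrib s_def)
    qed
    then have s': "\<forall>i\<ge>1. (\<Sum>\<gamma>\<in>{0..int N}. \<bar>tail k i \<gamma>\<bar>) \<le> s" by blast
    have sum2: "\<forall>i\<ge>1. pairing (tail k i) (\<lambda>_. 1) = 2" using sum_A by simp
    have step: "\<bar>dyadic_pairing (tail k) (Suc n) f - dyadic_pairing (tail k) n f\<bar> \<le> D * (3 / 4) ^ n" for n
    proof -
      have "C * (3 / 2) ^ n / 2 ^ n = C * (3 / 2 / 2) ^ n"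
        by (simp only: power_divide times_divide_eq_right)
      then show ?thesis
        using dyadic_pairing_step[OF mask_tail sum2 s' growth f, of n] by (simp add: D_def mult.assoc)
    qed
    \<comment> \<open>The partial geometric sum is kept exact so that the induction on
      \<open>m\<close> closes; 4 is 1 / (1 - 3/4).\<close>
    have "\<bar>dyadic_pairing (tail k) (n + m) f - dyadic_pairing (tail k) n f\<bar>
        \<le> 4 * D * ((3 / 4) ^ n - (3 / 4) ^ (n + m))" for n m
    proof (induction m)
      case (Suc m)
      then show ?case using step[of "n + m"] by (simp add: algebra_simps)
    qed simp
    moreover have "4 * D * ((3 / 4) ^ n - (3 / 4) ^ (n + m)) \<le> 4 * D * (3 / 4) ^ n" for n m
      using D by (intro mult_left_mono) auto
    ultimately show ?case by (meson order.trans)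
  qed
  then show ?thesis by (rule that)
qed

lemma dyadic_pairing_tail_bounded:
  assumes f: "\<Lambda>-lipschitz_on {0..2 * real N} f"
  obtains D where "\<forall>\<^sub>F k in sequentially. \<forall>n. \<bar>dyadic_pairing (tail k) n f\<bar> \<le> D"
proof -
  obtain D where D: "\<forall>\<^sub>F k in sequentially. \<forall>n m.
    \<bar>dyadic_pairing (tail k) (n + m) f - dyadic_pairing (tail k) n f\<bar> \<le> D * (3 / 4) ^ n"
    using dyadic_pairing_tail_Cauchy[OF f] by blast
  have "\<forall>\<^sub>F k in sequentially. \<forall>n. \<bar>dyadic_pairing (tail k) n f\<bar> \<le> \<bar>f 0\<bar> + D"
    using D
  proof eventually_elim
    case (elim k)
    have "dyadic_pairing (tail k) 0 f = f 0" by (simp add: dyadic_pairing_def)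
    moreover have "\<bar>dyadic_pairing (tail k) n f - dyadic_pairing (tail k) 0 f\<bar> \<le> D" for n
      using elim[rule_format, of 0 n] by simp
    ultimately have "\<bar>dyadic_pairing (tail k) n f\<bar> \<le> \<bar>f 0\<bar> + D" for n
      by (metis abs_triangle_ineq2 add.commute diff_le_eq order.trans)
    then show ?case by blast
  qed
  then show ?thesis by (rule that)
qed

text \<open>For a fixed number of steps only finitely many mask entries are involved, each of which
  converges.\<close>

lemma subdivision_iter_tail_tendsto:
  "(\<lambda>k. subdivision_iter (tail k) n delta_seq \<alpha>) \<longlonglongrightarrow> subdivision_iter (\<lambda>_. a) n delta_seq \<alpha>"
proof (induction n arbitrary: \<alpha>)
  case (Suc n)
  have "(\<lambda>k. A (k + Suc n) \<beta>) \<longlonglongrightarrow> a \<beta>" for \<beta>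
    by (rule LIMSEQ_ignore_initial_segment[OF A_tendsto])
  then show ?case
    unfolding subdivision_iter.simps subdivision_eq[OF mask_supp_iter_delta[OF mask_tail]]
      subdivision_eq[OF mask_supp_iter_delta[OF masks_a]]
    by (intro tendsto_intros Suc)
qed simp

lemma dyadic_pairing_tail_tendsto:
  "(\<lambda>k. dyadic_pairing (tail k) n f) \<longlonglongrightarrow> dyadic_pairing (\<lambda>_. a) n f"
  unfolding dyadic_pairing_def pairing_mask[OF mask_supp_iter_delta[OF mask_tail]]
    pairing_mask[OF mask_supp_iter_delta[OF masks_a]]
  by (intro tendsto_intros subdivision_iter_tail_tendsto) simp

text \<open>The level \<open>n\<^sub>0\<close> is fixed before k: there the stationary sum is at
  least 3 \<tau>, passing to the tail costs \<tau>, and the Cauchy estimate, uniform in k, costs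
  another \<tau> for all larger n. No limit in n of the tail itself is needed.\<close>

lemma dyadic_pairing_tail_lower:
  assumes f: "\<Lambda>-lipschitz_on {0..2 * real N} f"
    and \<tau>: "\<tau> > 0" "\<forall>\<^sub>F n in sequentially. dyadic_pairing (\<lambda>_. a) n f \<ge> 3 * \<tau>"
  obtains n\<^sub>0 where "\<forall>\<^sub>F k in sequentially. \<forall>n\<ge>n\<^sub>0. dyadic_pairing (tail k) n f \<ge> \<tau>"
proof -
  obtain D where D: "\<forall>\<^sub>F k in sequentially. \<forall>n m.
    \<bar>dyadic_pairing (tail k) (n + m) f - dyadic_pairing (tail k) n f\<bar> \<le> D * (3 / 4) ^ n"
    using dyadic_pairing_tail_Cauchy[OF f] by blast
  have "(\<lambda>n. D * (3 / 4) ^ n) \<longlonglongrightarrow> D * 0"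
    by (intro tendsto_intros LIMSEQ_power_zero) simp
  then have "\<forall>\<^sub>F n in sequentially. D * (3 / 4) ^ n < \<tau>"
    by (rule order_tendstoD) (use \<tau> in simp)
  with \<tau>(2) have "\<forall>\<^sub>F n in sequentially. dyadic_pairing (\<lambda>_. a) n f \<ge> 3 * \<tau> \<and> D * (3 / 4) ^ n < \<tau>"
    by eventually_elim simp
  then obtain n\<^sub>0 where n\<^sub>0: "dyadic_pairing (\<lambda>_. a) n\<^sub>0 f \<ge> 3 * \<tau>" "D * (3 / 4) ^ n\<^sub>0 < \<tau>"
    by (auto simp: eventually_sequentially)
  have "\<forall>\<^sub>F k in sequentially. dyadic_pairing (tail k) n\<^sub>0 f > 2 * \<tau>"
    by (rule order_tendstoD(1)[OF dyadic_pairing_tail_tendsto]) (use n\<^sub>0 \<tau> in linarith)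
  with D have "\<forall>\<^sub>F k in sequentially. \<forall>n\<ge>n\<^sub>0. dyadic_pairing (tail k) n f \<ge> \<tau>"
  proof eventually_elim
    case (elim k)
    show ?case
    proof (intro allI impI)
      fix n assume "n \<ge> n\<^sub>0"
      then obtain m where n: "n = n\<^sub>0 + m" using le_Suc_ex by blast
      show "dyadic_pairing (tail k) n f \<ge> \<tau>"
        unfolding n using elim(1)[rule_format, of n\<^sub>0 m] elim(2) n\<^sub>0(2) by linarith
    qed
  qed
  then show ?thesis by (rule that)
qed

end

section \<open>A test function detected by the stable limit\<close>

text \<open>The sign (-1)^\<alpha>, given by parity because \<alpha> may be negative.\<close>

definition alt_sign :: "int \<Rightarrow> real" where
  "alt_sign \<alpha> = (if even \<alpha> then 1 else - 1)"

lemma alt_sign_add: "alt_sign (\<alpha> + \<beta>) = alt_sign \<alpha> * alt_sign \<beta>"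
  and alt_sign_diff: "alt_sign (\<alpha> - \<beta>) = alt_sign \<alpha> * alt_sign \<beta>"
  and alt_sign_even [simp]: "alt_sign (2 * \<alpha>) = 1"
  and alt_sign_abs [simp]: "\<bar>alt_sign \<alpha>\<bar> = 1"
  by (auto simp: alt_sign_def)

lemma antiperiodic_int:
  fixes w :: "real \<Rightarrow> real"
  assumes w: "\<And>x. w (x + 1) = - w x"
  shows "w (x + of_int q) = alt_sign q * w x"
proof (induction q rule: int_induct[of _ 0])
  case (step1 q)
  then show ?case using w[of "x + of_int q"] by (simp add: add.assoc alt_sign_def)
next
  case (step2 q)
  then show ?case using w[of "x + of_int (q - 1)"] by (auto simp: add.assoc alt_sign_def split: if_splits)
qed (simp add: alt_sign_def)

lemma cos_diff_le:
  fixes x y :: real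
  shows "\<bar>cos x - cos y\<bar> \<le> \<bar>x - y\<bar>"
proof -
  have "\<bar>cos x - cos y\<bar> = 2 * (\<bar>sin ((x + y) / 2)\<bar> * \<bar>sin ((y - x) / 2)\<bar>)"
    by (simp add: cos_diff_cos abs_mult)
  also have "\<dots> \<le> 2 * (1 * \<bar>(y - x) / 2\<bar>)"
    by (intro mult_left_mono mult_mono abs_sin_x_le_abs_x) auto
  finally show ?thesis by simp
qed

text \<open>For \<phi> vanishing off [0, N] and x in [0, 1] the range of q catches every nonzero
  term, so this is the sum over all integers; q = -1 accounts for the end point x = 1.\<close>

definition alternating_sum :: "nat \<Rightarrow> (real \<Rightarrow> real) \<Rightarrow> real \<Rightarrow> real" where
  "alternating_sum N \<phi> x = (\<Sum>q\<in>{-1..int N}. alt_sign q * \<phi> (x + of_int q))"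

lemma continuous_alternating_sum:
  assumes "continuous_on UNIV \<phi>"
  shows "continuous_on UNIV (alternating_sum N \<phi>)"
proof -
  have "continuous_on UNIV (\<lambda>x. \<phi> (x + of_int q))" for q
    by (rule continuous_on_compose2[OF assms]) (auto intro: continuous_intros)
  then show ?thesis
    unfolding alternating_sum_def[abs_def] by (intro continuous_intros) auto
qed

text \<open>Stability is tested with the bounded sequence \<open>alt_sign\<close>. If the
  alternating sum vanished on (0, 1), then by continuity on [0, 1] and up to sign on every unit
  interval, the lower stability bound would force C1 \<le> 0. The point is interior to leave room
  for a bump around it.\<close>

lemma alternating_sum_nonzero:
  assumes stable: "Linf_stable \<phi>" and cont: "continuous_on UNIV \<phi>"
    and supp: "\<And>x. x \<notin> {0..real N} \<Longrightarrow> \<phi> x = 0"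
  obtains x where "0 < x" "x < 1" "alternating_sum N \<phi> x \<noteq> 0"
proof (rule ccontr)
  let ?g = "alternating_sum N \<phi>"
  assume "\<not> thesis"
  with that have "\<forall>x. 0 < x \<and> x < 1 \<longrightarrow> ?g x = 0" by blast
  then have "\<forall>x\<in>{0<..<1}. ?g x = 0" by simp
  then have g0: "?g x = 0" if "x \<in> {0..1}" for x
    using continuous_constant_on_closure[of "{0<..<1}" ?g 0 x] that
      continuous_on_subset[OF continuous_alternating_sum[OF cont]]
    by auto
  have zero: "(\<Sum>\<^sub>\<infinity>\<alpha>::int. alt_sign \<alpha> * \<phi> (x - of_int \<alpha>)) = 0" for x
  proof -
    let ?S = "{\<lfloor>x\<rfloor> - int N..\<lfloor>x\<rfloor> + 1}"
    have "\<phi> (x - of_int \<alpha>) = 0" if "\<alpha> \<notin> ?S" for \<alpha>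
    proof (rule supp)
      have "of_int \<alpha> < x - real N" if "\<alpha> < \<lfloor>x\<rfloor> - int N"
        using that by linarith
      moreover have "of_int \<alpha> > x" if "\<alpha> > \<lfloor>x\<rfloor> + 1"
        using that by linarith
      ultimately show "x - of_int \<alpha> \<notin> {0..real N}" using \<open>\<alpha> \<notin> ?S\<close> by auto
    qed
    then have "(\<Sum>\<^sub>\<infinity>\<alpha>::int. alt_sign \<alpha> * \<phi> (x - of_int \<alpha>))
        = (\<Sum>\<^sub>\<infinity>\<alpha>\<in>?S. alt_sign \<alpha> * \<phi> (x - of_int \<alpha>))"
      by (intro infsum_cong_neutral) auto
    also have "\<dots> = (\<Sum>\<alpha>\<in>?S. alt_sign \<alpha> * \<phi> (x - of_int \<alpha>))" by simp
    also have "\<dots> = (\<Sum>q\<in>{-1..int N}. alt_sign (\<lfloor>x\<rfloor> - q) * \<phi> (frac x + of_int q))"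
      by (rule sum.reindex_bij_witness[of _ "\<lambda>q. \<lfloor>x\<rfloor> - q" "\<lambda>\<alpha>. \<lfloor>x\<rfloor> - \<alpha>"]) (auto simp: frac_def)
    also have "\<dots> = alt_sign \<lfloor>x\<rfloor> * ?g (frac x)"
      by (simp add: alternating_sum_def alt_sign_diff sum_distrib_left mult.assoc)
    also have "?g (frac x) = 0"
      by (rule g0) (auto simp: frac_lt_1 less_imp_le)
    finally show ?thesis by simp
  qed
  have "bounded (range alt_sign)"
    by (auto simp: bounded_iff intro!: exI[of _ 1])
  then obtain C1 where "0 < C1"
    "ereal C1 * linf_norm alt_sign \<le> Linf_norm (\<lambda>x. \<Sum>\<^sub>\<infinity>\<alpha>::int. alt_sign \<alpha> * \<phi> (x - of_int \<alpha>))"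
    using stable unfolding Linf_stable_def by blast
  moreover have "linf_norm alt_sign = 1"
    unfolding linf_norm_def alt_sign_abs one_ereal_def[symmetric] by simp
  moreover have "Linf_norm (\<lambda>x. \<Sum>\<^sub>\<infinity>\<alpha>::int. alt_sign \<alpha> * \<phi> (x - of_int \<alpha>)) = 0"
    unfolding zero Linf_norm_def abs_zero zero_ereal_def[symmetric]
    by (rule esssup_const) simp
  ultimately show False by simp
qed

text \<open>Writing \<gamma> = r + 2^n q with 0 \<le> r < 2^n, antiperiodicity turns the shift by q
  into a sign, and the sum folds onto one unit interval.\<close>

lemma sum_antiperiodic_fold:
  fixes w \<phi> :: "real \<Rightarrow> real"
  assumes w: "\<And>x. w (x + 1) = - w x"
    and supp: "\<And>x. x \<notin> {0..real N} \<Longrightarrow> \<phi> x = 0"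
  shows "(\<Sum>\<gamma>\<in>{0..int (2 ^ n * N)}. \<phi> (of_int \<gamma> / 2 ^ n) * w (of_int \<gamma> / 2 ^ n))
    = (\<Sum>r\<in>{0..<2 ^ n}. alternating_sum N \<phi> (of_int r / 2 ^ n) * w (of_int r / 2 ^ n))"
proof -
  let ?f = "\<lambda>\<gamma>::int. \<phi> (of_int \<gamma> / 2 ^ n) * w (of_int \<gamma> / 2 ^ n)"
  \<comment> \<open>Each element of \<open>?T\<close> is r + 2^n q for exactly one pair with -1
    \<le> q \<le> N; beyond the support of \<phi> only zero terms are added.\<close>
  let ?T = "{- (2 ^ n)..<2 ^ n * (int N + 1)}"
  have "alternating_sum N \<phi> (of_int r / 2 ^ n) * w (of_int r / 2 ^ n) = (\<Sum>q\<in>{-1..int N}. ?f (r + 2 ^ n * q))" for r :: int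
  proof -
    have "of_int (r + 2 ^ n * q) / 2 ^ n = of_int r / 2 ^ n + real_of_int q" for q
      by (simp add: field_simps)
    then show ?thesis
      by (simp only: alternating_sum_def antiperiodic_int[where w = w, OF w] sum_distrib_right) (simp add: mult_ac)
  qed
  then have "(\<Sum>r\<in>{0..<2 ^ n}. alternating_sum N \<phi> (of_int r / 2 ^ n) * w (of_int r / 2 ^ n))
     = (\<Sum>(r, q)\<in>{0..<2 ^ n} \<times> {-1..int N}. ?f (r + 2 ^ n * q))"
    by (simp add: sum.cartesian_product)
  also have "\<dots> = (\<Sum>\<gamma>\<in>?T. ?f \<gamma>)"
  proof (rule sum.reindex_bij_witness[of _ "\<lambda>\<gamma>. (\<gamma> mod 2 ^ n, \<gamma> div 2 ^ n)" "\<lambda>(r, q). r + 2 ^ n * q"], goal_cases)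
    case (2 p)
    obtain r q where p: "p = (r, q)" "0 \<le> r" "r < 2 ^ n" "-1 \<le> q" "q \<le> int N" using 2 by auto
    have "2 ^ n * (-1) \<le> 2 ^ n * q" "2 ^ n * q \<le> 2 ^ n * int N" using p by (intro mult_left_mono; simp)+
    then have "r + 2 ^ n * q \<in> ?T"
      unfolding atLeastLessThan_iff ring_distribs using p by linarith
    then show ?case by (simp add: p(1))
  next
    case (1 p)
    then show ?case by auto
  next
    case (3 \<gamma>)
    show ?case by simp
  next
    case (4 \<gamma>)
    define q r where "q = \<gamma> div 2 ^ n" and "r = \<gamma> mod 2 ^ n"
    have \<gamma>: "\<gamma> = 2 ^ n * q + r" "0 \<le> r" "r < 2 ^ n" by (auto simp: q_def r_def)
    have *: "2 ^ n * (-1) < 2 ^ n * (q + 1)" "2 ^ n * q < 2 ^ n * (int N + 1)"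
      using 4 \<gamma> unfolding atLeastLessThan_iff ring_distribs by linarith+
    have "-1 < q + 1" "q < int N + 1"
      by (rule mult_left_less_imp_less[OF *(1)] mult_left_less_imp_less[OF *(2)], simp)+
    then show ?case using \<gamma>(2,3) by (simp add: q_def r_def)
  next
    case (5 p)
    show ?case by (simp add: case_prod_beta)
  qed
  also have "\<dots> = (\<Sum>\<gamma>\<in>{0..int (2 ^ n * N)}. ?f \<gamma>)"
  proof (rule sum.mono_neutral_right)
    show "{0..int (2 ^ n * N)} \<subseteq> ?T"
    proof
      fix \<gamma> assume "\<gamma> \<in> {0..int (2 ^ n * N)}"
      then have "0 \<le> \<gamma>" "\<gamma> \<le> 2 ^ n * int N" "(0::int) < 2 ^ n" by simp_all
      then show "\<gamma> \<in> ?T" unfolding atLeastLessThan_iff ring_distribs by linarith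
    qed
    have "\<phi> (of_int \<gamma> / 2 ^ n) = 0" if "\<gamma> \<notin> {0..int (2 ^ n * N)}" for \<gamma>
    proof (rule supp)
      show "of_int \<gamma> / 2 ^ n \<notin> {0..real N}"
      proof
        assume "of_int \<gamma> / 2 ^ n \<in> {0..real N}"
        then have "0 \<le> real_of_int \<gamma>" "real_of_int \<gamma> \<le> real_of_int (int (2 ^ n * N))"
          by (auto simp: field_simps)
        then have "0 \<le> \<gamma>" "\<gamma> \<le> int (2 ^ n * N)" unfolding of_int_le_iff by simp_all
        with that show False by simp
      qed
    qed
    then show "\<forall>\<gamma>\<in>?T - {0..int (2 ^ n * N)}. ?f \<gamma> = 0" by simp
  qed simp
  finally show ?thesis by simp
qed

text \<open>An interval of length 2 d holds at least 2 d 2^n - 1 points of mesh 2^-n, and the terms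
  outside it are nonnegative.\<close>

lemma dyadic_sum_lower:
  fixes h :: "real \<Rightarrow> real"
  assumes h: "\<And>x. x \<in> {0..1} \<Longrightarrow> h x \<ge> 0"
    and d: "d > 0" "x\<^sub>0 - d > 0" "x\<^sub>0 + d < 1" and \<epsilon>: "\<epsilon> > 0" "\<And>x. \<bar>x - x\<^sub>0\<bar> \<le> d \<Longrightarrow> h x \<ge> \<epsilon>"
  shows "(\<Sum>r\<in>{0..<2 ^ n}. h (of_int r / 2 ^ n)) \<ge> (2 * 2 ^ n * d - 1) * \<epsilon>"
proof -
  let ?R = "{\<lceil>2 ^ n * (x\<^sub>0 - d)\<rceil>..\<lfloor>2 ^ n * (x\<^sub>0 + d)\<rfloor>}"
  have R: "\<bar>of_int r / 2 ^ n - x\<^sub>0\<bar> \<le> d" if "r \<in> ?R" for r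
  proof -
    have "2 ^ n * (x\<^sub>0 - d) \<le> of_int r" "of_int r \<le> 2 ^ n * (x\<^sub>0 + d)"
      using that by (auto simp: ceiling_le_iff le_floor_iff)
    then have "x\<^sub>0 - d \<le> of_int r / 2 ^ n" "of_int r / 2 ^ n \<le> x\<^sub>0 + d"
      by (simp_all add: field_simps)
    then show ?thesis by linarith
  qed
  have sub: "?R \<subseteq> {0..<2 ^ n}"
  proof
    fix r assume "r \<in> ?R"
    from R[OF this] d have "0 \<le> of_int r / (2 ^ n :: real)" "of_int r / (2 ^ n :: real) < 1" by linarith+
    then have "0 \<le> r" "real_of_int r < real_of_int (2 ^ n)" by (simp_all add: field_simps)
    then show "r \<in> {0..<2 ^ n}" unfolding of_int_less_iff by simp
  qed
  have "2 * 2 ^ n * d - 1 \<le> real (card ?R)"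
  proof -
    have "2 * 2 ^ n * d = 2 ^ n * (x\<^sub>0 + d) - 2 ^ n * (x\<^sub>0 - d)" by (simp add: algebra_simps)
    then show ?thesis by (simp only: card_atLeastAtMost_int) linarith
  qed
  then have "(2 * 2 ^ n * d - 1) * \<epsilon> \<le> (\<Sum>r\<in>?R. \<epsilon>)" using \<epsilon> by (simp add: mult_right_mono)
  also have "\<dots> \<le> (\<Sum>r\<in>?R. h (of_int r / 2 ^ n))" by (intro sum_mono \<epsilon> R)
  also have "\<dots> \<le> (\<Sum>r\<in>{0..<2 ^ n}. h (of_int r / 2 ^ n))"
  proof (rule sum_mono2[OF _ sub])
    fix r :: int assume "r \<in> {0..<2 ^ n} - ?R"
    then have "0 \<le> r" "real_of_int r \<le> real_of_int (2 ^ n)" unfolding of_int_le_iff by simp_all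
    then show "0 \<le> h (of_int r / 2 ^ n)" by (intro h) (simp add: divide_simps)
  qed simp
  finally show ?thesis .
qed

text \<open>A cosine of period 2 with its peak at \<open>x\<^sub>0\<close> is cut at height \<kappa>
  on both sides. The cut is an odd operation, so antiperiodicity survives, and what remains in
  [0, 1] is one bump on which g keeps its sign.\<close>

lemma test_function_exists:
  fixes g :: "real \<Rightarrow> real"
  assumes g: "continuous_on UNIV g" and x\<^sub>0: "0 < x\<^sub>0" "x\<^sub>0 < 1" "g x\<^sub>0 \<noteq> 0"
  obtains w where "\<And>x. w (x + 1) = - w x" "\<And>x. \<bar>w x\<bar> \<le> (2::real)" "(2 * pi)-lipschitz_on UNIV w"
    "\<And>x. x \<in> {0..1} \<Longrightarrow> g x * w x \<ge> 0" "g x\<^sub>0 * w x\<^sub>0 > 0"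
proof -
  define \<sigma> where "\<sigma> = sgn (g x\<^sub>0)"
  have \<sigma>: "\<bar>\<sigma>\<bar> = 1" "\<sigma> * g x\<^sub>0 > 0" using x\<^sub>0 by (auto simp: \<sigma>_def sgn_if)
  have "isCont (\<lambda>x. \<sigma> * g x) x\<^sub>0"
    using g by (intro continuous_intros) (auto simp: continuous_on_eq_continuous_at)
  then have "(\<lambda>x. \<sigma> * g x) \<midarrow>x\<^sub>0\<rightarrow> \<sigma> * g x\<^sub>0" by (rule isContD)
  from order_tendstoD(1)[OF this \<sigma>(2)]
  obtain d where d: "d > 0" "\<And>x. x \<noteq> x\<^sub>0 \<Longrightarrow> dist x x\<^sub>0 < d \<Longrightarrow> \<sigma> * g x > 0"
    unfolding eventually_at by blast
  \<comment> \<open>The bump has half-width \<eta>. Besides lying where g keeps its sign, it must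
    stay inside [0, 1], which also keeps the opposite bumps around \<open>x\<^sub>0 - 1\<close> and
    \<open>x\<^sub>0 + 1\<close> out of the interior of [0, 1].\<close>
  define \<eta> where "\<eta> = min d (min x\<^sub>0 (1 - x\<^sub>0))"
  have \<eta>: "\<eta> > 0" "\<eta> \<le> d" "\<eta> \<le> x\<^sub>0" "\<eta> \<le> 1 - x\<^sub>0" "\<eta> \<le> 1/2"
    using d x\<^sub>0 by (auto simp: \<eta>_def min_def)
  define \<kappa> where "\<kappa> = cos (pi * \<eta>)"
  have \<kappa>0: "\<kappa> \<ge> 0"
    unfolding \<kappa>_def using \<eta> by (intro cos_ge_zero) (auto simp: field_simps intro: order.trans[of _ 0])
  have \<kappa>1: "\<kappa> < 1"
    unfolding \<kappa>_def using \<eta> cos_monotone_0_pi[of 0 "pi * \<eta>"] by (simp add: mult_le_cancel_left1)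
  define c where "c x = cos (pi * (x - x\<^sub>0))" for x
  define w where "w x = \<sigma> * (max 0 (c x - \<kappa>) - max 0 (- c x - \<kappa>))" for x
  have c1: "\<bar>c x\<bar> \<le> 1" for x by (simp add: c_def)
  have c_abs: "c x = cos (pi * \<bar>x - x\<^sub>0\<bar>)" for x
  proof -
    have "pi * \<bar>x - x\<^sub>0\<bar> = \<bar>pi * (x - x\<^sub>0)\<bar>" by (simp add: abs_mult)
    then show ?thesis by (simp only: c_def cos_abs_real)
  qed
  show ?thesis
  proof (rule that)
    fix x
    have "c (x + 1) = - c x"
      using cos_periodic_pi[of "pi * (x - x\<^sub>0)"] by (simp add: c_def algebra_simps)
    then show "w (x + 1) = - w x" by (simp add: w_def algebra_simps)
    show "\<bar>w x\<bar> \<le> 2"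
      using c1[of x] \<kappa>0 \<sigma>(1) by (simp add: w_def abs_mult max_def) linarith
  next
    show "(2 * pi)-lipschitz_on UNIV w"
    proof (rule lipschitz_onI)
      fix x y
      have "\<bar>w x - w y\<bar> = \<bar>(max 0 (c x - \<kappa>) - max 0 (- c x - \<kappa>)) - (max 0 (c y - \<kappa>) - max 0 (- c y - \<kappa>))\<bar>"
        unfolding w_def right_diff_distrib[symmetric] abs_mult \<sigma>(1) by simp
      also have "\<dots> \<le> 2 * \<bar>c x - c y\<bar>"
      proof -
        have "\<bar>max 0 (c x - \<kappa>) - max 0 (c y - \<kappa>)\<bar> \<le> \<bar>c x - c y\<bar>"
          "\<bar>max 0 (- c x - \<kappa>) - max 0 (- c y - \<kappa>)\<bar> \<le> \<bar>c x - c y\<bar>"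
          by (auto simp: max_def)
        moreover have "\<bar>(p - r) - (q - s)\<bar> \<le> 2 * D" if "\<bar>p - q\<bar> \<le> D" "\<bar>r - s\<bar> \<le> D" for p q r s D :: real
          using that by linarith
        ultimately show ?thesis by blast
      qed
      also have "\<dots> \<le> 2 * \<bar>pi * (x - x\<^sub>0) - pi * (y - x\<^sub>0)\<bar>"
        unfolding c_def by (intro mult_left_mono cos_diff_le) simp
      also have "\<dots> = 2 * pi * \<bar>x - y\<bar>"
      proof -
        have "pi * (x - x\<^sub>0) - pi * (y - x\<^sub>0) = pi * (x - y)" by (simp add: algebra_simps)
        then show ?thesis by (simp add: abs_mult)
      qed
      finally show "dist (w x) (w y) \<le> 2 * pi * dist x y" by (simp add: dist_real_def)
    qed simp
  next
    fix x :: real assume x: "x \<in> {0..1}"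
    show "g x * w x \<ge> 0"
    proof (cases "\<bar>x - x\<^sub>0\<bar> < \<eta>")
      case True
      have "\<kappa> \<le> c x"
        unfolding c_abs \<kappa>_def using True \<eta> by (intro cos_monotone_0_pi_le) (auto simp: mult_le_cancel_left1)
      then have wx: "w x = \<sigma> * (c x - \<kappa>)" using \<kappa>0 by (simp add: w_def max_def)
      have "\<sigma> * g x > 0"
        using d(2)[of x] True \<eta> \<sigma>(2) by (cases "x = x\<^sub>0") (auto simp: dist_real_def)
      have "g x * w x = (\<sigma> * g x) * (c x - \<kappa>)"
        unfolding wx by simp
      then show ?thesis
        using \<open>\<sigma> * g x > 0\<close> \<open>\<kappa> \<le> c x\<close> by (metis diff_ge_0_iff_ge less_imp_le mult_nonneg_nonneg)
    next
      case False
      have *: "\<bar>x - x\<^sub>0\<bar> \<le> 1 - \<eta>" using x \<eta> x\<^sub>0 by auto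
      have "c x \<le> \<kappa>"
        unfolding c_abs \<kappa>_def using False \<eta> *
        by (intro cos_monotone_0_pi_le) (auto simp: mult_le_cancel_left1)
      moreover have "cos (pi * (1 - \<eta>)) \<le> c x"
        unfolding c_abs using False \<eta> *
        by (intro cos_monotone_0_pi_le) (auto simp: mult_le_cancel_left1)
      then have "- \<kappa> \<le> c x" by (simp add: \<kappa>_def right_diff_distrib cos_diff)
      ultimately have "max 0 (c x - \<kappa>) = 0" "max 0 (- c x - \<kappa>) = 0" by linarith+
      then show ?thesis by (simp add: w_def)
    qed
  next
    have "w x\<^sub>0 = \<sigma> * (1 - \<kappa>)" using \<kappa>0 \<kappa>1 by (simp add: w_def c_def)
    then have "g x\<^sub>0 * w x\<^sub>0 = (\<sigma> * g x\<^sub>0) * (1 - \<kappa>)" by simp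
    also have "\<dots> > 0" using \<kappa>1 by (intro mult_pos_pos[OF \<sigma>(2)]) simp
    finally show "g x\<^sub>0 * w x\<^sub>0 > 0" .
  qed
qed

lemma (in asymptotic_masks) stable_test_function:
  assumes stable: "Linf_stable \<phi>"
  obtains w \<tau> where "\<And>x. w (x + 1) = - w x" "\<And>x. \<bar>w x\<bar> \<le> (2::real)" "(2 * pi)-lipschitz_on UNIV w"
    "\<tau> > 0" "\<forall>\<^sub>F n in sequentially. dyadic_pairing (\<lambda>_. a) n w \<ge> 3 * \<tau>"
proof -
  have cont: "continuous_on UNIV \<phi>"
    using limit_\<phi> C_diff_imp_continuous by (auto simp: limit_function_def)
  note supp = limit_function_support[OF masks_a limit_\<phi>]
  let ?g = "alternating_sum N \<phi>"
  obtain x\<^sub>0 where x\<^sub>0: "0 < x\<^sub>0" "x\<^sub>0 < 1" "?g x\<^sub>0 \<noteq> 0"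
    using alternating_sum_nonzero[OF stable cont supp] by blast
  obtain w where w: "\<And>x. w (x + 1) = - w x" "\<And>x. \<bar>w x\<bar> \<le> (2::real)" "(2 * pi)-lipschitz_on UNIV w"
    "\<And>x. x \<in> {0..1} \<Longrightarrow> ?g x * w x \<ge> 0" "?g x\<^sub>0 * w x\<^sub>0 > 0"
    using test_function_exists[OF continuous_alternating_sum[OF cont] x\<^sub>0] by blast
  define h where "h x = ?g x * w x" for x
  define \<epsilon> where "\<epsilon> = h x\<^sub>0 / 2"
  have "h x\<^sub>0 > 0" unfolding h_def by (rule w(5))
  then have \<epsilon>: "0 < \<epsilon>" "\<epsilon> < h x\<^sub>0" by (auto simp: \<epsilon>_def)
  have "continuous_on UNIV h"
    unfolding h_def by (intro continuous_intros continuous_alternating_sum[OF cont] lipschitz_on_continuous_on[OF w(3)])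
  then have "h \<midarrow>x\<^sub>0\<rightarrow> h x\<^sub>0" by (auto simp: continuous_on_eq_continuous_at isCont_def)
  from order_tendstoD(1)[OF this \<epsilon>(2)]
  obtain d\<^sub>1 where d\<^sub>1: "d\<^sub>1 > 0" "\<And>x. x \<noteq> x\<^sub>0 \<Longrightarrow> dist x x\<^sub>0 < d\<^sub>1 \<Longrightarrow> \<epsilon> < h x"
    unfolding eventually_at by blast
  define d where "d = min d\<^sub>1 (min x\<^sub>0 (1 - x\<^sub>0)) / 2"
  let ?m = "min d\<^sub>1 (min x\<^sub>0 (1 - x\<^sub>0))"
  have m: "?m > 0" "?m \<le> d\<^sub>1" "?m \<le> x\<^sub>0" "?m \<le> 1 - x\<^sub>0" using d\<^sub>1(1) x\<^sub>0 by auto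
  have d: "d > 0" "d < d\<^sub>1" "x\<^sub>0 - d > 0" "x\<^sub>0 + d < 1" unfolding d_def using m d\<^sub>1(1) x\<^sub>0 by linarith+
  have h\<epsilon>: "h x \<ge> \<epsilon>" if "\<bar>x - x\<^sub>0\<bar> \<le> d" for x
    using d\<^sub>1(2)[of x] d(2) that \<epsilon>(2) by (cases "x = x\<^sub>0") (auto simp: dist_real_def)
  have h0: "h x \<ge> 0" if "x \<in> {0..1}" for x unfolding h_def by (rule w(4)[OF that])
  \<comment> \<open>Once 2^n d \<ge> 1, the sum of \<phi> against \<open>w\<close> is at least 2^n d
    \<epsilon>. The value of \<open>e\<close> lets the replacement of \<phi> by the iterate cost at
    most half of this, and the remaining half, normalised, is 3 \<tau>.\<close>
  define \<tau> where "\<tau> = d * \<epsilon> / 6"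
  define e where "e = d * \<epsilon> / (4 * (real N + 1))"
  have \<tau>: "\<tau> > 0" and e: "e > 0" using d(1) \<epsilon>(1) by (auto simp: \<tau>_def e_def)
  have "(\<lambda>n. (1/2 :: real) ^ n) \<longlonglongrightarrow> 0" by (rule LIMSEQ_power_zero) simp
  then have ev: "\<forall>\<^sub>F n in sequentially. (1/2) ^ n < d" by (rule order_tendstoD) (use d in simp)
  have "\<forall>\<^sub>F n in sequentially. dyadic_pairing (\<lambda>_. a) n w \<ge> 3 * \<tau>"
    using ev limit_function_eventually[OF limit_\<phi> e]
  proof eventually_elim
    case (elim n)
    let ?x = "subdivision_iter (\<lambda>_. a) n delta_seq"
    let ?S = "{0..int (2 ^ n * N)}"
    let ?R = "\<Sum>\<gamma>\<in>?S. \<phi> (of_int \<gamma> / 2 ^ n) * w (of_int \<gamma> / 2 ^ n)"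
    have p1: "1 \<le> 2 ^ n * d"
      using elim(1) by (simp add: power_one_over field_simps)
    have "(2 * 2 ^ n * d - 1) * \<epsilon> \<le> (\<Sum>r\<in>{0..<2 ^ n}. h (of_int r / 2 ^ n))"
      by (rule dyadic_sum_lower[OF h0 d(1,3,4) \<epsilon>(1) h\<epsilon>])
    also have "\<dots> = ?R"
      unfolding h_def by (rule sum_antiperiodic_fold[where w = w and \<phi> = \<phi>, OF w(1) supp, symmetric])
    finally have "(2 * 2 ^ n * d - 1) * \<epsilon> \<le> ?R" .
    moreover have "(2 ^ n * d) * \<epsilon> \<le> (2 * 2 ^ n * d - 1) * \<epsilon>"
      by (intro mult_right_mono) (use p1 \<epsilon>(1) in linarith)+
    ultimately have R: "2 ^ n * (d * \<epsilon>) \<le> ?R" by (simp add: mult.assoc)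
    have "\<bar>?R - pairing ?x (\<lambda>\<gamma>. w (of_int \<gamma> / 2 ^ n))\<bar>
       = \<bar>\<Sum>\<gamma>\<in>?S. (\<phi> (of_int \<gamma> / 2 ^ n) - ?x \<gamma>) * w (of_int \<gamma> / 2 ^ n)\<bar>"
      unfolding pairing_mask[OF mask_supp_iter_delta[OF masks_a]]
      by (simp only: sum_subtractf[symmetric] left_diff_distrib)
    also have "\<dots> \<le> (\<Sum>\<gamma>\<in>?S. e * 2)"
      by (rule order.trans[OF sum_abs sum_mono])
        (use elim(2) w(2) e in \<open>auto simp: abs_mult intro!: mult_mono\<close>)
    also have "\<dots> = (2 ^ n * real N + 1) * (e * 2)" by simp
    also have "\<dots> \<le> (2 ^ n * (real N + 1)) * (e * 2)"
      using e by (intro mult_right_mono) (auto simp: algebra_simps)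
    also have "\<dots> = 2 ^ n * (d * \<epsilon>) / 2" by (simp add: e_def field_simps)
    finally have "2 ^ n * (d * \<epsilon>) / 2 \<le> pairing ?x (\<lambda>\<gamma>. w (of_int \<gamma> / 2 ^ n))"
      using R by linarith
    then show ?case unfolding dyadic_pairing_def \<tau>_def by (simp add: field_simps)
  qed
  with that[OF w(1-3) \<tau>] show ?thesis by blast
qed

section \<open>Moments\<close>

lemma lipschitz_power_mult:
  fixes w :: "real \<Rightarrow> real"
  assumes w: "\<Lambda>-lipschitz_on {0..R} w" "\<And>x. \<bar>w x\<bar> \<le> b" and R: "R \<ge> 0"
  obtains \<Lambda>' where "\<Lambda>'-lipschitz_on {0..R} (\<lambda>x. x ^ p * w x)"
proof -
  have b: "0 \<le> b" using w(2)[of 0] by linarith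
  have "\<exists>\<Lambda>'. \<Lambda>'-lipschitz_on {0..R} (\<lambda>x. x ^ p * w x)"
  proof (induction p)
    case 0
    show ?case using w(1) by auto
  next
    case (Suc p)
    then obtain \<Lambda>' where L: "\<Lambda>'-lipschitz_on {0..R} (\<lambda>x. x ^ p * w x)" by blast
    note L0 = lipschitz_on_nonneg[OF L]
    define g where "g x = x ^ p * w x" for x
    have g: "\<bar>g x\<bar> \<le> R ^ p * b" if "x \<in> {0..R}" for x
      using that w(2)[of x] R b by (auto simp: g_def abs_mult intro!: mult_mono power_mono)
    have "(R * \<Lambda>' + R ^ p * b)-lipschitz_on {0..R} (\<lambda>x. x ^ Suc p * w x)"
    proof (rule lipschitz_onI)
      fix x y assume xy: "x \<in> {0..R}" "y \<in> {0..R}"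
      have "\<bar>x * g x - y * g y\<bar> = \<bar>x * (g x - g y) + g y * (x - y)\<bar>" by (simp add: algebra_simps)
      also have "\<dots> \<le> \<bar>x\<bar> * \<bar>g x - g y\<bar> + \<bar>g y\<bar> * \<bar>x - y\<bar>"
        unfolding abs_mult[symmetric] by (rule abs_triangle_ineq)
      also have "\<dots> \<le> R * (\<Lambda>' * \<bar>x - y\<bar>) + (R ^ p * b) * \<bar>x - y\<bar>"
        using lipschitz_onD[OF L xy] g[OF xy(2)] xy R
        by (intro add_mono mult_mono) (auto simp: dist_real_def g_def)
      finally show "dist (x ^ Suc p * w x) (y ^ Suc p * w y) \<le> (R * \<Lambda>' + R ^ p * b) * dist x y"
        by (simp add: dist_real_def g_def algebra_simps)
    qed (use L0 R b in simp)
    then show ?case by blast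
  qed
  then show ?thesis using that by blast
qed

text \<open>The divisor consists of 2^k for the mesh and 2^(k j) for rescaling \<beta> to the point
  \<beta> / 2^k.\<close>

definition alternating_moment :: "(nat \<Rightarrow> int \<Rightarrow> real) \<Rightarrow> nat \<Rightarrow> nat \<Rightarrow> real" where
  "alternating_moment A k j =
     pairing (subdivision_iter A k delta_seq) (\<lambda>\<beta>. alt_sign \<beta> * of_int \<beta> ^ j) / 2 ^ (k * Suc j)"

definition iter_moment :: "(nat \<Rightarrow> int \<Rightarrow> real) \<Rightarrow> nat \<Rightarrow> nat \<Rightarrow> real" where
  "iter_moment A k j = pairing (subdivision_iter A k delta_seq) (\<lambda>\<beta>. of_int \<beta> ^ j) / 2 ^ (k * Suc j)"

definition mask_moment :: "(int \<Rightarrow> real) \<Rightarrow> nat \<Rightarrow> real" where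
  "mask_moment a j = pairing a (\<lambda>\<gamma>. alt_sign \<gamma> * of_int \<gamma> ^ j)"

lemma power_mult_cancel: "i \<le> j \<Longrightarrow> (2::real) ^ (k * Suc i) / 2 ^ (k * j + k) = 1 / 2 ^ (k * (j - i))"
  by (simp add: field_simps flip: power_add) (simp add: algebra_simps flip: distrib_left)

text \<open>A fine index is 2^n \<beta> + \<gamma>, with \<beta> from the first k levels and
  \<gamma> from the tail. In the variable y = \<gamma> / 2^n the weight becomes (-1)^\<beta> w(y),
  and the binomial theorem splits (\<beta> + y)^j. In the term i = j the tail meets \<open>w\<close>
  alone, which is the pairing bounded below.\<close>

lemma oscillating_pairing_expansion:
  fixes w :: "real \<Rightarrow> real"
  assumes A: "\<forall>k\<ge>1. mask_supp N (A k)" and w: "\<And>x. w (x + 1) = - w x"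
  shows "pairing (subdivision_iter A (k + n) delta_seq)
      (\<lambda>\<gamma>. (of_int \<gamma> / 2 ^ (k + n)) ^ j * w (of_int \<gamma> / 2 ^ n)) / 2 ^ (k + n)
    = (\<Sum>i\<le>j. real (j choose i) / 2 ^ (k * (j - i)) * alternating_moment A k i *
        dyadic_pairing (\<lambda>i. A (k + i)) n (\<lambda>x. x ^ (j - i) * w x))"
proof -
  let ?c = "subdivision_iter A k delta_seq"
  let ?d = "subdivision_iter (\<lambda>i. A (k + i)) n delta_seq"
  have A': "\<forall>i\<ge>1. mask_supp N (A (k + i))" using A by simp
  let ?P = "\<lambda>i. pairing ?c (\<lambda>\<beta>. alt_sign \<beta> * of_int \<beta> ^ i)"
  let ?Q = "\<lambda>i. pairing ?d (\<lambda>\<gamma>. (of_int \<gamma> / 2 ^ n) ^ (j - i) * w (of_int \<gamma> / 2 ^ n))"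
  have expand: "(of_int (2 ^ n * \<beta> + \<gamma>) / 2 ^ (k + n)) ^ j * w (of_int (2 ^ n * \<beta> + \<gamma>) / 2 ^ n)
     = (\<Sum>i\<le>j. (real (j choose i) / 2 ^ (k * j)) * ((alt_sign \<beta> * of_int \<beta> ^ i) *
         ((of_int \<gamma> / 2 ^ n) ^ (j - i) * w (of_int \<gamma> / 2 ^ n))))" for \<beta> \<gamma> :: int
  proof -
    have 1: "of_int (2 ^ n * \<beta> + \<gamma>) / 2 ^ n = of_int \<gamma> / 2 ^ n + real_of_int \<beta>"
      by (simp add: field_simps)
    have 2: "of_int (2 ^ n * \<beta> + \<gamma>) / 2 ^ (k + n) = (real_of_int \<beta> + of_int \<gamma> / 2 ^ n) / 2 ^ k"
      by (simp add: field_simps power_add)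
    show ?thesis
      unfolding 1 2 antiperiodic_int[where w = w, OF w] power_divide[of "_ + _"] binomial_ring
        sum_divide_distrib sum_distrib_right power_mult[of 2 k j]
      by (rule sum.cong) simp_all
  qed
  have "pairing (subdivision_iter A (k + n) delta_seq)
      (\<lambda>\<gamma>. (of_int \<gamma> / 2 ^ (k + n)) ^ j * w (of_int \<gamma> / 2 ^ n))
     = pairing ?c (\<lambda>\<beta>. pairing ?d (\<lambda>\<gamma>. (of_int (2 ^ n * \<beta> + \<gamma>) / 2 ^ (k + n)) ^ j * w (of_int (2 ^ n * \<beta> + \<gamma>) / 2 ^ n)))"
    unfolding subdivision_iter_add by (rule pairing_iter[OF A' mask_supp_iter_delta[OF A]])
  also have "\<dots> = (\<Sum>i\<le>j. (real (j choose i) / 2 ^ (k * j)) * (?P i * ?Q i))"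
    unfolding expand pairing_sum pairing_scale pairing_scale_right ..
  finally have "pairing (subdivision_iter A (k + n) delta_seq)
      (\<lambda>\<gamma>. (of_int \<gamma> / 2 ^ (k + n)) ^ j * w (of_int \<gamma> / 2 ^ n)) / 2 ^ (k + n)
     = (\<Sum>i\<le>j. (real (j choose i) / 2 ^ (k * j)) * (?P i * ?Q i) / 2 ^ (k + n))"
    by (simp add: sum_divide_distrib)
  also have "\<dots> = (\<Sum>i\<le>j. real (j choose i) / 2 ^ (k * (j - i)) * alternating_moment A k i *
        dyadic_pairing (\<lambda>i. A (k + i)) n (\<lambda>x. x ^ (j - i) * w x))"
  proof (rule sum.cong[OF refl])
    fix i assume "i \<in> {..j}"
    then have "real (j choose i) / 2 ^ (k * (j - i)) = real (j choose i) * (2 ^ (k * Suc i) / 2 ^ (k * j + k))"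
      using power_mult_cancel[of i j k] by simp
    then show "(real (j choose i) / 2 ^ (k * j)) * (?P i * ?Q i) / 2 ^ (k + n) =
       real (j choose i) / 2 ^ (k * (j - i)) * alternating_moment A k i *
        dyadic_pairing (\<lambda>i. A (k + i)) n (\<lambda>x. x ^ (j - i) * w x)"
      unfolding alternating_moment_def dyadic_pairing_def by (simp add: power_add)
  qed
  finally show ?thesis .
qed

text \<open>The last step produces indices 2\<beta> + \<gamma> whose sign depends only on \<gamma>,
  so the twisting falls entirely on the newest mask and the older iterate enters through ordinary
  moments. This is what isolates a single mask.\<close>

lemma alternating_moment_Suc:
  assumes A: "\<forall>k\<ge>1. mask_supp N (A k)"
  shows "alternating_moment A (Suc k) j
    = (\<Sum>i\<le>j. real (j choose i) / 2 * (mask_moment (A (Suc k)) i / 2 ^ (Suc k * i)) * iter_moment A k (j - i))"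
proof -
  let ?c = "subdivision_iter A k delta_seq"
  let ?P = "\<lambda>i. pairing ?c (\<lambda>\<beta>. of_int \<beta> ^ (j - i))"
  have expand: "alt_sign (2 * \<beta> + \<gamma>) * of_int (2 * \<beta> + \<gamma>) ^ j =
     (\<Sum>i\<le>j. real (j choose i) * 2 ^ (j - i) * (of_int \<beta> ^ (j - i) * (alt_sign \<gamma> * of_int \<gamma> ^ i)))" for \<beta> \<gamma>
  proof -
    have 1: "alt_sign (2 * \<beta> + \<gamma>) = alt_sign \<gamma>" by (simp add: alt_sign_add)
    have 2: "of_int (2 * \<beta> + \<gamma>) = real_of_int \<gamma> + 2 * of_int \<beta>" by simp
    show ?thesis
      unfolding 1 2 binomial_ring sum_distrib_left power_mult_distrib by (rule sum.cong) simp_all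
  qed
  have "pairing (subdivision_iter A (Suc k) delta_seq) (\<lambda>\<beta>. alt_sign \<beta> * of_int \<beta> ^ j)
    = pairing ?c (\<lambda>\<beta>. pairing (A (Suc k)) (\<lambda>\<gamma>. alt_sign (2 * \<beta> + \<gamma>) * of_int (2 * \<beta> + \<gamma>) ^ j))"
    unfolding subdivision_iter.simps
    by (rule pairing_subdivision[OF A[rule_format] mask_supp_iter_delta[OF A]]) simp
  also have "\<dots> = (\<Sum>i\<le>j. real (j choose i) * 2 ^ (j - i) * (?P i * mask_moment (A (Suc k)) i))"
    unfolding expand pairing_sum pairing_scale pairing_scale_right mask_moment_def ..
  finally have "alternating_moment A (Suc k) j =
     (\<Sum>i\<le>j. real (j choose i) * 2 ^ (j - i) * (?P i * mask_moment (A (Suc k)) i) / 2 ^ (Suc k * Suc j))"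
    unfolding alternating_moment_def by (simp add: sum_divide_distrib)
  also have "\<dots> = (\<Sum>i\<le>j. real (j choose i) / 2 * (mask_moment (A (Suc k)) i / 2 ^ (Suc k * i)) * iter_moment A k (j - i))"
  proof (rule sum.cong[OF refl])
    fix i assume "i \<in> {..j}"
    then obtain p where p: "j = i + p" by (auto simp: le_iff_add)
    have "(2::real) ^ (Suc k * Suc j) = 2 ^ p * (2 * 2 ^ (Suc k * i) * 2 ^ (k * Suc p))"
      unfolding p by (simp add: power_add[symmetric] power_Suc[symmetric] algebra_simps del: power_Suc)
    then show "real (j choose i) * 2 ^ (j - i) * (?P i * mask_moment (A (Suc k)) i) / 2 ^ (Suc k * Suc j) =
      real (j choose i) / 2 * (mask_moment (A (Suc k)) i / 2 ^ (Suc k * i)) * iter_moment A k (j - i)"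
      unfolding iter_moment_def p by (simp add: mult_ac del: power_Suc mult_Suc mult_Suc_right)
  qed
  finally show ?thesis .
qed

lemma iter_moment_0:
  assumes A: "\<forall>k\<ge>1. mask_supp N (A k)" "\<forall>k\<ge>1. pairing (A k) (\<lambda>_. 1) = 2"
  shows "iter_moment A k 0 = 1"
proof -
  have "pairing (subdivision_iter A k delta_seq) (\<lambda>_. 1) = 2 ^ k"
  proof (induction k)
    case (Suc k)
    have "pairing (subdivision_iter A (Suc k) delta_seq) (\<lambda>_. 1)
        = pairing (subdivision_iter A k delta_seq) (\<lambda>_. pairing (A (Suc k)) (\<lambda>_. 1))"
      unfolding subdivision_iter.simps
      by (rule pairing_subdivision[OF A(1)[rule_format] mask_supp_iter_delta[OF A(1)]]) simp
    also have "\<dots> = pairing (subdivision_iter A k delta_seq) (\<lambda>_. 2 * 1)" using A(2) by simp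
    finally show ?case unfolding pairing_scale Suc by simp
  qed simp
  then show ?thesis by (simp add: iter_moment_def)
qed

lemma iter_moment_bounded:
  assumes A: "\<forall>k\<ge>1. mask_supp N (A k)" and B: "\<And>n \<alpha>. \<bar>subdivision_iter A n delta_seq \<alpha>\<bar> \<le> B"
  shows "\<bar>iter_moment A k j\<bar> \<le> (real N + 1) * B * real N ^ j"
proof -
  have B0: "B \<ge> 0" using B[of 0 0] by linarith
  have "\<bar>pairing (subdivision_iter A k delta_seq) (\<lambda>\<beta>. of_int \<beta> ^ j)\<bar> \<le> (real (2 ^ k * N) + 1) * (B * (2 ^ k * real N) ^ j)"
  proof (rule pairing_abs_le[OF mask_supp_iter_delta[OF A] B])
    fix \<alpha> assume \<alpha>: "0 \<le> \<alpha>" "\<alpha> \<le> int (2 ^ k * N)"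
    then have "real_of_int \<alpha> \<le> real_of_int (int (2 ^ k * N))" by (simp only: of_int_le_iff)
    with \<alpha> show "\<bar>real_of_int \<alpha> ^ j\<bar> \<le> (2 ^ k * real N) ^ j"
      unfolding power_abs by (intro power_mono) auto
  qed
  also have "\<dots> \<le> (2 ^ k * (real N + 1)) * (B * (2 ^ k * real N) ^ j)"
    using B0 by (intro mult_right_mono) (auto simp: algebra_simps)
  also have "\<dots> = ((real N + 1) * B * real N ^ j) * 2 ^ (k * Suc j)"
    unfolding power_mult power_mult_distrib by simp
  finally show ?thesis
    by (simp add: iter_moment_def abs_divide pos_divide_le_eq)
qed

text \<open>The weight \<open>u\<close> is quantified after the threshold for \<open>m\<close>,
  because the weights to be inserted vary with \<open>m\<close>.\<close>

lemma discretization_error: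
  assumes A: "\<forall>k\<ge>1. mask_supp N (A k)" and g: "limit_function l A delta_seq g" and e: "e > 0"
  shows "\<forall>\<^sub>F m in sequentially. \<forall>u. (\<forall>\<gamma>. \<bar>u \<gamma>\<bar> \<le> 2) \<longrightarrow>
    \<bar>pairing (subdivision_iter A m delta_seq) (\<lambda>\<gamma>. (of_int \<gamma> / 2 ^ m) ^ j * u \<gamma>)
      - pairing (\<lambda>\<gamma>. (of_int \<gamma> / 2 ^ m) ^ j * g (of_int \<gamma> / 2 ^ m)) u\<bar> / 2 ^ m \<le> e"
proof -
  \<comment> \<open>The summand 1 added to N^j keeps \<open>q\<close> positive when N = 0 and j >
    0.\<close>
  define q where "q = 2 * (real N + 1) * (real N ^ j + 1)"
  have q: "q > 0" unfolding q_def by (intro mult_pos_pos add_nonneg_pos) auto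
  define e' where "e' = e / q"
  have e': "e' > 0" using e q by (simp add: e'_def)
  show ?thesis using limit_function_eventually[OF g e']
  proof (eventually_elim, intro allI impI)
    fix m and u :: "int \<Rightarrow> real"
    let ?S = "{0..int (2 ^ m * N)}"
    let ?c = "subdivision_iter A m delta_seq"
    let ?x = "\<lambda>\<gamma>::int. real_of_int \<gamma> / 2 ^ m"
    assume close: "\<forall>\<alpha>. \<bar>g (?x \<alpha>) - ?c \<alpha>\<bar> \<le> e'" and u: "\<forall>\<gamma>. \<bar>u \<gamma>\<bar> \<le> 2"
    have x: "?x \<gamma> \<in> {0..real N} \<longleftrightarrow> \<gamma> \<in> ?S" for \<gamma>
    proof -
      have "?x \<gamma> \<in> {0..real N} \<longleftrightarrow> 0 \<le> real_of_int \<gamma> \<and> real_of_int \<gamma> \<le> real_of_int (int (2 ^ m * N))"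
        by (auto simp: field_simps)
      then show ?thesis unfolding of_int_le_iff by simp
    qed
    have p: "pairing (\<lambda>\<gamma>. ?x \<gamma> ^ j * g (?x \<gamma>)) u = (\<Sum>\<gamma>\<in>?S. ?x \<gamma> ^ j * g (?x \<gamma>) * u \<gamma>)"
      by (rule pairing_superset) (use limit_function_support[OF A g] x in auto)
    have "\<bar>pairing ?c (\<lambda>\<gamma>. ?x \<gamma> ^ j * u \<gamma>) - pairing (\<lambda>\<gamma>. ?x \<gamma> ^ j * g (?x \<gamma>)) u\<bar>
       = \<bar>\<Sum>\<gamma>\<in>?S. (?c \<gamma> - g (?x \<gamma>)) * (?x \<gamma> ^ j * u \<gamma>)\<bar>"
      unfolding pairing_mask[OF mask_supp_iter_delta[OF A]] p sum_subtractf[symmetric]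
      by (intro arg_cong[of _ _ abs] sum.cong) (simp_all add: algebra_simps)
    also have "\<dots> \<le> (\<Sum>\<gamma>\<in>?S. e' * (real N ^ j * 2))"
    proof (rule order.trans[OF sum_abs sum_mono])
      fix \<gamma> assume "\<gamma> \<in> ?S"
      then have "0 \<le> ?x \<gamma>" "?x \<gamma> \<le> real N" using x by auto
      then have "\<bar>?x \<gamma> ^ j\<bar> \<le> real N ^ j" unfolding power_abs by (intro power_mono) auto
      moreover have "\<bar>?c \<gamma> - g (?x \<gamma>)\<bar> \<le> e'" using close by (simp add: abs_minus_commute)
      ultimately show "\<bar>(?c \<gamma> - g (?x \<gamma>)) * (?x \<gamma> ^ j * u \<gamma>)\<bar> \<le> e' * (real N ^ j * 2)"
        unfolding abs_mult using u e' by (intro mult_mono) auto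
    qed
    also have "\<dots> = (2 ^ m * real N + 1) * (e' * (real N ^ j * 2))" by simp
    also have "\<dots> \<le> (2 ^ m * (real N + 1)) * (e' * ((real N ^ j + 1) * 2))"
      using e' by (intro mult_mono) (auto simp: algebra_simps)
    also have "\<dots> = 2 ^ m * e" using q by (simp add: e'_def q_def field_simps)
    finally show "\<bar>pairing ?c (\<lambda>\<gamma>. ?x \<gamma> ^ j * u \<gamma>) - pairing (\<lambda>\<gamma>. ?x \<gamma> ^ j * g (?x \<gamma>)) u\<bar> / 2 ^ m \<le> e"
      by (simp add: pos_divide_le_eq mult.commute)
  qed
qed

section \<open>Decay of the moments and of the symbol derivatives\<close>

context asymptotic_masks
begin

text \<open>Strong induction on \<open>j\<close>: in the expansion the lower moments are already
  o(2^(-l k)) with bounded coefficients, and the coefficient of the top one is at least \<tau>, so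
  it can be solved for.\<close>

lemma alternating_moment_tendsto:
  assumes stable: "Linf_stable \<phi>" and g: "limit_function l A delta_seq g" and "j \<le> l"
  shows "(\<lambda>k. 2 ^ (l * k) * alternating_moment A k j) \<longlonglongrightarrow> 0"
proof -
  obtain w \<tau> where w: "\<And>x. w (x + 1) = - w x" "\<And>x. \<bar>w x\<bar> \<le> (2::real)" "(2 * pi)-lipschitz_on UNIV w"
    and \<tau>: "\<tau> > 0" "\<forall>\<^sub>F n in sequentially. dyadic_pairing (\<lambda>_. a) n w \<ge> 3 * \<tau>"
    using stable_test_function[OF stable] by blast
  have wL: "(2 * pi)-lipschitz_on {0..2 * real N} w" by (rule lipschitz_on_subset[OF w(3)]) simp
  obtain n\<^sub>0 where n\<^sub>0: "\<forall>\<^sub>F k in sequentially. \<forall>n\<ge>n\<^sub>0. dyadic_pairing (tail k) n w \<ge> \<tau>"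
    using dyadic_pairing_tail_lower[OF wL \<tau>] by blast
  have "\<exists>D. \<forall>\<^sub>F k in sequentially. \<forall>n. \<bar>dyadic_pairing (tail k) n (\<lambda>x. x ^ p * w x)\<bar> \<le> D" for p
  proof -
    obtain \<Lambda>' where "\<Lambda>'-lipschitz_on {0..2 * real N} (\<lambda>x. x ^ p * w x)"
      using lipschitz_power_mult[OF wL w(2), of p] by auto
    from dyadic_pairing_tail_bounded[OF this] show ?thesis by blast
  qed
  from choice[OF allI[OF this]]
  obtain D where D: "\<forall>p. \<forall>\<^sub>F k in sequentially. \<forall>n. \<bar>dyadic_pairing (tail k) n (\<lambda>x. x ^ p * w x)\<bar> \<le> D p" ..
  have D': "\<forall>\<^sub>F k in sequentially. \<forall>p\<in>{..l}. \<forall>n. \<bar>dyadic_pairing (tail k) n (\<lambda>x. x ^ p * w x)\<bar> \<le> D p"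
    by (rule eventually_ball_finite[OF finite_atMost ballI[OF spec[OF D]]])
  have gC: "C_diff l g" using g by (simp add: limit_function_def)
  show ?thesis using \<open>j \<le> l\<close>
  proof (induction j rule: less_induct)
    case (less j)
    define F where "F x = x ^ j * g x" for x
    have FC: "C_diff l F" unfolding F_def by (intro C_diff_mult C_diff_power gC)
    have F0: "F x = 0" if "x \<notin> {- real N..real N}" for x
      unfolding F_def using that limit_function_support[OF mask_A g, of x] by auto
    define R where "R k = (\<Sum>i<j. real (j choose i) * D (j - i) * \<bar>2 ^ (l * k) * alternating_moment A k i\<bar>)" for k
    have "R \<longlonglongrightarrow> (\<Sum>i<j. real (j choose i) * D (j - i) * \<bar>0\<bar>)"
      unfolding R_def by (intro tendsto_intros less.IH) (use less.prems in auto)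
    then have R: "R \<longlonglongrightarrow> 0" by simp
    show ?case
    proof (rule LIMSEQ_I)
      fix r :: real assume r: "r > 0"
      \<comment> \<open>Two errors, from oscillation and from the lower moments, must add up to less
        than r \<tau>.\<close>
      define \<epsilon> where "\<epsilon> = r * \<tau> / 3"
      have \<epsilon>: "\<epsilon> > 0" using r \<tau> by (simp add: \<epsilon>_def)
      have evR: "\<forall>\<^sub>F k in sequentially. R k < \<epsilon>" by (rule order_tendstoD(2)[OF R \<epsilon>])
      have osc: "\<forall>\<^sub>F k in sequentially. \<forall>n. \<bar>pairing (\<lambda>\<gamma>. F (of_int \<gamma> / 2 ^ (k + n)))
          (\<lambda>\<gamma>. w (of_int \<gamma> / 2 ^ n))\<bar> / 2 ^ (k + n) \<le> \<epsilon> / 2 ^ (l * k)"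
        using w(1,2) F0 \<epsilon> by (intro oscillating_sum_small[OF FC, where L = "real N"]) auto
      have "\<forall>\<^sub>F k in sequentially. norm (2 ^ (l * k) * alternating_moment A k j - 0) < r"
        using n\<^sub>0 D' evR osc
      proof eventually_elim
        case (elim k)
        let ?M = "alternating_moment A k"
        let ?T = "\<lambda>n p. dyadic_pairing (tail k) n (\<lambda>x. x ^ p * w x)"
        let ?Q = "\<Sum>i<j. real (j choose i) * D (j - i) * \<bar>?M i\<bar>"
        \<comment> \<open>Here k is fixed and n is free: both sides except \<open>e\<close> are
          independent of n, so letting n grow removes the discretisation error. No rate for the
          convergence to \<open>g\<close> is required.\<close>
        have "\<bar>?M j\<bar> * \<tau> \<le> (\<epsilon> / 2 ^ (l * k) + ?Q) + e" if e: "e > 0" for e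
        proof -
          obtain m\<^sub>0 where m\<^sub>0: "\<And>m u. m \<ge> m\<^sub>0 \<Longrightarrow> (\<forall>\<gamma>. \<bar>u \<gamma>\<bar> \<le> 2) \<Longrightarrow>
            \<bar>pairing (subdivision_iter A m delta_seq) (\<lambda>\<gamma>. (of_int \<gamma> / 2 ^ m) ^ j * u \<gamma>)
              - pairing (\<lambda>\<gamma>. (of_int \<gamma> / 2 ^ m) ^ j * g (of_int \<gamma> / 2 ^ m)) u\<bar> / 2 ^ m \<le> e"
            using discretization_error[OF mask_A g e, of j] unfolding eventually_sequentially by blast
          define n where "n = max n\<^sub>0 m\<^sub>0"
          have n: "n \<ge> n\<^sub>0" "k + n \<ge> m\<^sub>0" by (auto simp: n_def)
          define u where "u \<gamma> = w (of_int \<gamma> / 2 ^ n)" for \<gamma> :: int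
          define E where "E = pairing (subdivision_iter A (k + n) delta_seq) (\<lambda>\<gamma>. (of_int \<gamma> / 2 ^ (k + n)) ^ j * u \<gamma>)"
          define P where "P = pairing (\<lambda>\<gamma>. F (of_int \<gamma> / 2 ^ (k + n))) u"
          have "\<bar>E - P\<bar> / 2 ^ (k + n) \<le> e"
            unfolding E_def P_def F_def by (rule m\<^sub>0[OF n(2)]) (simp add: u_def w(2))
          moreover have "\<bar>P\<bar> / 2 ^ (k + n) \<le> \<epsilon> / 2 ^ (l * k)"
            unfolding P_def u_def using elim(4) by simp
          moreover have "\<bar>E\<bar> / 2 ^ (k + n) \<le> \<bar>P\<bar> / 2 ^ (k + n) + \<bar>E - P\<bar> / 2 ^ (k + n)"
            unfolding add_divide_distrib[symmetric] by (intro divide_right_mono) auto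
          ultimately have E: "\<bar>E / 2 ^ (k + n)\<bar> \<le> \<epsilon> / 2 ^ (l * k) + e"
            unfolding abs_divide by simp
          define t where "t i = real (j choose i) / 2 ^ (k * (j - i)) * ?M i * ?T n (j - i)" for i
          have "E / 2 ^ (k + n) = (\<Sum>i\<le>j. t i)"
            unfolding E_def u_def t_def by (rule oscillating_pairing_expansion[where w = w, OF mask_A w(1)])
          also have "\<dots> = t j + (\<Sum>i<j. t i)" by (simp add: lessThan_Suc_atMost[symmetric])
          also have "t j = ?M j * dyadic_pairing (tail k) n w" by (simp add: t_def)
          finally have M: "?M j * dyadic_pairing (tail k) n w = E / 2 ^ (k + n) - (\<Sum>i<j. t i)" by simp
          have "\<bar>t i\<bar> \<le> real (j choose i) * D (j - i) * \<bar>?M i\<bar>" if "i < j" for i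
          proof -
            have T: "\<bar>?T n (j - i)\<bar> \<le> D (j - i)" using elim(2) less.prems by simp
            have "\<bar>t i\<bar> = (real (j choose i) * \<bar>?M i\<bar>) * (\<bar>?T n (j - i)\<bar> / 2 ^ (k * (j - i)))"
              by (simp add: t_def abs_mult)
            also have "\<dots> \<le> (real (j choose i) * \<bar>?M i\<bar>) * D (j - i)"
            proof (rule mult_left_mono)
              have "\<bar>?T n (j - i)\<bar> / 2 ^ (k * (j - i)) \<le> \<bar>?T n (j - i)\<bar> / 1"
                by (rule divide_left_mono) auto
              with T show "\<bar>?T n (j - i)\<bar> / 2 ^ (k * (j - i)) \<le> D (j - i)" by simp
            qed simp
            finally show ?thesis by (simp add: mult_ac)
          qed
          then have "\<bar>\<Sum>i<j. t i\<bar> \<le> ?Q" by (intro order.trans[OF sum_abs sum_mono]) auto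
          moreover have "\<bar>?M j\<bar> * \<tau> \<le> \<bar>?M j * dyadic_pairing (tail k) n w\<bar>"
            unfolding abs_mult using elim(1) n(1) \<tau>(1) by (intro mult_left_mono) (auto intro: order.trans[OF _ abs_ge_self])
          ultimately show ?thesis using E unfolding M by linarith
        qed
        then have "\<bar>?M j\<bar> * \<tau> \<le> \<epsilon> / 2 ^ (l * k) + ?Q" by (rule field_le_epsilon)
        then have "2 ^ (l * k) * (\<bar>?M j\<bar> * \<tau>) \<le> 2 ^ (l * k) * (\<epsilon> / 2 ^ (l * k) + ?Q)"
          by (rule mult_left_mono) simp
        also have "\<dots> = \<epsilon> + R k"
          unfolding R_def by (simp add: ring_distribs sum_distrib_left abs_mult mult_ac)
        also have "\<dots> < r * \<tau>" using elim(3) \<epsilon> by (simp add: \<epsilon>_def)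
        finally have "(2 ^ (l * k) * \<bar>?M j\<bar>) * \<tau> < r * \<tau>" by (simp add: mult.assoc)
        then show ?case using \<tau>(1) by (simp add: abs_mult)
      qed
      then show "\<exists>no. \<forall>n\<ge>no. norm (2 ^ (l * n) * alternating_moment A n j - 0) < r"
        unfolding eventually_sequentially .
    qed
  qed
qed

text \<open>Solves the triangular system for the newest mask: the diagonal coefficient is half the
  zeroth ordinary moment, which equals 1, and all other ordinary moments are bounded.\<close>

lemma mask_moment_tendsto:
  assumes stable: "Linf_stable \<phi>" and g: "limit_function l A delta_seq g" and "j \<le> l"
  shows "(\<lambda>k. 2 ^ (l * k) * (mask_moment (A k) j / 2 ^ (k * j))) \<longlonglongrightarrow> 0"
  using \<open>j \<le> l\<close>
proof (induction j rule: less_induct)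
  case (less j)
  obtain B where B: "\<And>n \<alpha>. \<bar>subdivision_iter A n delta_seq \<alpha>\<bar> \<le> B"
    using subdivision_iter_bounded[OF mask_A g] by metis
  define m where "m i k = 2 ^ (l * k) * (mask_moment (A k) i / 2 ^ (k * i))" for i k
  have m: "(\<lambda>k. m i (Suc k)) \<longlonglongrightarrow> 0" if "i < j" for i
    using less.IH[of i] less.prems that LIMSEQ_Suc unfolding m_def by fastforce
  have M: "(\<lambda>k. 2 ^ (l * Suc k) * alternating_moment A (Suc k) j) \<longlonglongrightarrow> 0"
    by (rule LIMSEQ_Suc[OF alternating_moment_tendsto[OF stable g less.prems]])
  have "(\<lambda>k. real (j choose i) / 2 * (iter_moment A k (j - i) * m i (Suc k))) \<longlonglongrightarrow> real (j choose i) / 2 * 0"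
    if "i < j" for i
  proof (rule tendsto_mult_left[OF Lim_null_comparison])
    let ?b = "(real N + 1) * B * real N ^ (j - i)"
    show "\<forall>\<^sub>F k in sequentially. norm (iter_moment A k (j - i) * m i (Suc k)) \<le> ?b * \<bar>m i (Suc k)\<bar>"
      using iter_moment_bounded[OF mask_A B] by (intro always_eventually) (simp add: abs_mult mult_right_mono)
    show "(\<lambda>k. ?b * \<bar>m i (Suc k)\<bar>) \<longlonglongrightarrow> 0"
      using tendsto_mult_left[OF tendsto_rabs[OF m[OF that]], of ?b] by simp
  qed
  then have S: "(\<lambda>k. \<Sum>i<j. real (j choose i) / 2 * (iter_moment A k (j - i) * m i (Suc k))) \<longlonglongrightarrow> (\<Sum>i<j. real (j choose i) / 2 * 0)"
    by (intro tendsto_sum) auto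
  have eq: "m j (Suc k) = 2 * (2 ^ (l * Suc k) * alternating_moment A (Suc k) j
      - (\<Sum>i<j. real (j choose i) / 2 * (iter_moment A k (j - i) * m i (Suc k))))" for k
  proof -
    have "2 ^ (l * Suc k) * alternating_moment A (Suc k) j =
        (\<Sum>i\<le>j. real (j choose i) / 2 * (iter_moment A k (j - i) * m i (Suc k)))"
      unfolding alternating_moment_Suc[OF mask_A] sum_distrib_left m_def
      by (rule sum.cong) (simp_all add: mult_ac)
    also have "\<dots> = (\<Sum>i<j. real (j choose i) / 2 * (iter_moment A k (j - i) * m i (Suc k))) + m j (Suc k) / 2"
      using iter_moment_0[OF mask_A sum_A] by (simp add: lessThan_Suc_atMost[symmetric])
    finally show ?thesis by simp
  qed
  have "(\<lambda>k. m j (Suc k)) \<longlonglongrightarrow> 2 * (0 - (\<Sum>i<j. real (j choose i) / 2 * 0))"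
    unfolding eq by (intro tendsto_mult_left tendsto_diff M S)
  then have "(\<lambda>k. m j (Suc k)) \<longlonglongrightarrow> 0" by simp
  then show ?case unfolding m_def[symmetric] by (rule LIMSEQ_imp_Suc)
qed

text \<open>Splitting the new factor \<gamma> - j gives one term with a further power of \<gamma>
  and one with a spare factor 2^-k. The free power \<open>r\<close> is what lets the induction
  absorb the first of these.\<close>

lemma mask_falling_moment_tendsto:
  assumes stable: "Linf_stable \<phi>" and g: "limit_function l A delta_seq g" and "r + j \<le> l"
  shows "(\<lambda>k. 2 ^ (l * k) * (pairing (A k) (\<lambda>\<gamma>. alt_sign \<gamma> * of_int \<gamma> ^ r * (\<Prod>t<j. of_int \<gamma> - real t)) / 2 ^ (k * (r + j)))) \<longlonglongrightarrow> 0"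
  using \<open>r + j \<le> l\<close>
proof (induction j arbitrary: r)
  case 0
  then show ?case using mask_moment_tendsto[OF stable g, of r] by (simp add: mask_moment_def)
next
  case (Suc j)
  let ?p = "\<lambda>k r. pairing (A k) (\<lambda>\<gamma>. alt_sign \<gamma> * of_int \<gamma> ^ r * (\<Prod>t<j. of_int \<gamma> - real t))"
  have "alt_sign \<gamma> * of_int \<gamma> ^ r * (\<Prod>t<Suc j. of_int \<gamma> - real t) =
      alt_sign \<gamma> * of_int \<gamma> ^ Suc r * (\<Prod>t<j. of_int \<gamma> - real t) -
      real j * (alt_sign \<gamma> * of_int \<gamma> ^ r * (\<Prod>t<j. of_int \<gamma> - real t))" for \<gamma>
    by (simp add: algebra_simps)
  then have "2 ^ (l * k) * (pairing (A k) (\<lambda>\<gamma>. alt_sign \<gamma> * of_int \<gamma> ^ r * (\<Prod>t<Suc j. of_int \<gamma> - real t)) / 2 ^ (k * (r + Suc j)))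
    = 2 ^ (l * k) * (?p k (Suc r) / 2 ^ (k * (Suc r + j))) -
      real j * ((1 / 2) ^ k * (2 ^ (l * k) * (?p k r / 2 ^ (k * (r + j)))))" for k
    by (simp only: pairing_diff pairing_scale) (simp add: power_add power_one_over diff_divide_distrib right_diff_distrib mult_ac)
  moreover have "(\<lambda>k. 2 ^ (l * k) * (?p k (Suc r) / 2 ^ (k * (Suc r + j))) -
      real j * ((1 / 2) ^ k * (2 ^ (l * k) * (?p k r / 2 ^ (k * (r + j)))))) \<longlonglongrightarrow> 0 - real j * (0 * 0)"
    by (intro tendsto_diff tendsto_mult_left tendsto_mult LIMSEQ_power_zero Suc.IH) (use Suc.prems in auto)
  ultimately show ?case by simp
qed

end

section \<open>Derivatives of the symbol at -1 as twisted moments\<close>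

lemma mask_symbol_eq:
  assumes "mask_supp N b"
  shows "mask_symbol b z = (\<Sum>i\<le>N. of_real (b (int i)) * z ^ i)"
proof -
  have "mask_symbol b z = (\<Sum>\<^sub>\<infinity>\<alpha>\<in>{0..int N}. of_real (b \<alpha>) * z powi \<alpha>)"
    unfolding mask_symbol_def
    by (rule infsum_cong_neutral) (use mask_suppD[OF assms] in auto)
  also have "\<dots> = (\<Sum>\<alpha>\<in>{0..int N}. of_real (b \<alpha>) * z powi \<alpha>)" by simp
  also have "\<dots> = (\<Sum>i\<le>N. of_real (b (int i)) * z ^ i)"
    by (rule sum.reindex_bij_witness[of _ int nat]) (auto simp: power_int_def nat_le_iff)
  finally show ?thesis .
qed

lemma pairing_eq_sum_nat:
  assumes "mask_supp N b"
  shows "pairing b f = (\<Sum>i\<le>N. b (int i) * f (int i))"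
  unfolding pairing_mask[OF assms]
  by (rule sum.reindex_bij_witness[of _ int nat]) (auto simp: nat_le_iff)

text \<open>For i < j the truncated exponent \<open>i - j\<close> is 0, but the falling product
  contains the factor t = i and vanishes.\<close>

lemma higher_deriv_power_sum:
  fixes c :: "nat \<Rightarrow> complex"
  shows "(deriv ^^ j) (\<lambda>z. \<Sum>i\<le>N. c i * z ^ i) = (\<lambda>z. \<Sum>i\<le>N. c i * (\<Prod>t<j. of_nat i - of_nat t) * z ^ (i - j))"
proof (induction j)
  case (Suc j)
  have "((\<lambda>z. \<Sum>i\<le>N. c i * (\<Prod>t<j. of_nat i - of_nat t) * z ^ (i - j)) has_field_derivative
     (\<Sum>i\<le>N. c i * (\<Prod>t<Suc j. of_nat i - of_nat t) * z ^ (i - Suc j))) (at z)" for z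
  proof (rule DERIV_sum)
    fix i
    have *: "(\<Prod>t<j. of_nat i - of_nat t) * of_nat (i - j) = (\<Prod>t<Suc j. of_nat i - of_nat t :: complex)"
    proof (cases "j \<le> i")
      case False
      then have "(\<Prod>t<j. of_nat i - of_nat t :: complex) = 0" by (intro prod_zero) auto
      then show ?thesis by simp
    qed (simp add: of_nat_diff)
    have "((\<lambda>z. c i * (\<Prod>t<j. of_nat i - of_nat t) * z ^ (i - j)) has_field_derivative
       c i * (\<Prod>t<j. of_nat i - of_nat t) * (of_nat (i - j) * z ^ (i - j - 1))) (at z)"
      by (auto intro!: derivative_eq_intros)
    then show "((\<lambda>z. c i * (\<Prod>t<j. of_nat i - of_nat t) * z ^ (i - j)) has_field_derivative
       c i * (\<Prod>t<Suc j. of_nat i - of_nat t) * z ^ (i - Suc j)) (at z)"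
      unfolding *[symmetric] by (simp add: mult.assoc)
  qed
  then show ?case by (auto simp: Suc intro!: ext DERIV_imp_deriv)
qed simp

text \<open>Since (-1)^(i - j) = (-1)^j (-1)^i, the dependence on j is one global sign, which the
  modulus removes.\<close>

lemma cmod_deriv_mask_symbol:
  assumes b: "mask_supp N b"
  shows "cmod ((deriv ^^ j) (mask_symbol b) (-1)) = \<bar>pairing b (\<lambda>\<gamma>. alt_sign \<gamma> * (\<Prod>t<j. of_int \<gamma> - real t))\<bar>"
proof -
  have "mask_symbol b = (\<lambda>z. \<Sum>i\<le>N. of_real (b (int i)) * z ^ i)"
    by (rule ext) (rule mask_symbol_eq[OF b])
  then have "(deriv ^^ j) (mask_symbol b) (-1)
     = (\<Sum>i\<le>N. of_real (b (int i)) * (\<Prod>t<j. of_nat i - of_nat t) * (- 1) ^ (i - j))"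
    by (simp only: higher_deriv_power_sum)
  also have "\<dots> = (\<Sum>i\<le>N. of_real ((- 1) ^ j * (b (int i) * (alt_sign (int i) * (\<Prod>t<j. real i - real t)))))"
  proof (rule sum.cong[OF refl])
    fix i
    show "of_real (b (int i)) * (\<Prod>t<j. of_nat i - of_nat t) * (- 1) ^ (i - j) =
      complex_of_real ((- 1) ^ j * (b (int i) * (alt_sign (int i) * (\<Prod>t<j. real i - real t))))"
    proof (cases "j \<le> i")
      case False
      then have "(\<Prod>t<j. of_nat i - of_nat t :: complex) = 0" "(\<Prod>t<j. real i - real t) = 0"
        by (auto intro!: prod_zero)
      then show ?thesis by simp
    next
      case True
      then have "(- 1) ^ (i - j) = (- 1 :: complex) ^ j * of_real (alt_sign (int i))"
        by (auto simp: alt_sign_def minus_one_power_iff)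
      then show ?thesis by simp
    qed
  qed
  also have "\<dots> = of_real ((- 1) ^ j * pairing b (\<lambda>\<gamma>. alt_sign \<gamma> * (\<Prod>t<j. of_int \<gamma> - real t)))"
    unfolding pairing_eq_sum_nat[OF b] sum_distrib_left of_real_sum by simp
  finally show ?thesis by (simp only: norm_of_real) (simp add: abs_mult power_abs)
qed

theorem theorem1:
  fixes l N :: nat
    and a :: "int \<Rightarrow> real"
    and A :: "nat \<Rightarrow> int \<Rightarrow> real"
    and \<phi> :: "real \<Rightarrow> real"
  assumes "mask_supp N a"
    and "\<And>k. k \<ge> 1 \<Longrightarrow> mask_supp N (A k)"
    and "converges_to 0 (\<lambda>_. a)"
    and "limit_function 0 (\<lambda>_. a) delta_seq \<phi>"
    and "Linf_stable \<phi>"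
    and "\<And>k. k \<ge> 1 \<Longrightarrow> mask_symbol (A k) 1 = 2"
    and "\<And>\<alpha>. (\<lambda>k. A k \<alpha>) \<longlonglongrightarrow> a \<alpha>"
    and "converges_to l A"
  shows "(\<lambda>k. 2 ^ (l * k) * sum_rule_defect l A k) \<longlonglongrightarrow> 0"
proof -
  have sum2: "pairing (A k) (\<lambda>_. 1) = 2" if "k \<ge> 1" for k
  proof -
    have "complex_of_real (pairing (A k) (\<lambda>_. 1)) = mask_symbol (A k) 1"
      using pairing_eq_sum_nat[OF assms(2)[OF that]] mask_symbol_eq[OF assms(2)[OF that]] by simp
    also have "\<dots> = complex_of_real 2" using assms(6)[OF that] by simp
    finally show ?thesis by (simp only: of_real_eq_iff)
  qed
  interpret asymptotic_masks N a A \<phi>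
    by unfold_locales (use assms sum2 in auto)
  have "bounded (range delta_seq)"
    by (auto simp: bounded_iff delta_seq_def intro!: exI[of _ 1])
  then obtain g where g: "limit_function l A delta_seq g"
    using assms(8) unfolding converges_to_def by blast
  define d where "d j k = cmod ((deriv ^^ j) (mask_symbol (A k)) (-1)) / 2 ^ (k * j)" for j k
  have d: "(\<lambda>k. 2 ^ (l * k) * d j k) \<longlonglongrightarrow> 0" if "j \<le> l" for j
  proof -
    let ?p = "\<lambda>k. 2 ^ (l * k) * (pairing (A k) (\<lambda>\<gamma>. alt_sign \<gamma> * (\<Prod>t<j. of_int \<gamma> - real t)) / 2 ^ (k * j))"
    have "?p \<longlonglongrightarrow> 0"
      using mask_falling_moment_tendsto[OF assms(5) g, of 0 j] that by simp
    then have "(\<lambda>k. \<bar>?p k\<bar>) \<longlonglongrightarrow> 0" by (rule tendsto_rabs_zero)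
    \<comment> \<open>Finite support is known only for the masks from index 1 on.\<close>
    moreover have "\<forall>\<^sub>F k in sequentially. \<bar>?p k\<bar> = 2 ^ (l * k) * d j k"
      using eventually_ge_at_top[of 1]
      by eventually_elim (simp add: d_def cmod_deriv_mask_symbol[OF assms(2)] abs_mult)
    ultimately show ?thesis by (rule Lim_transform_eventually)
  qed
  \<comment> \<open>A maximum of finitely many nonnegative numbers is dominated by their sum, which
    reduces the claim to each order j separately.\<close>
  have "(\<lambda>k. \<Sum>j\<in>{0..l}. 2 ^ (l * k) * d j k) \<longlonglongrightarrow> (\<Sum>j\<in>{0..l}. 0)"
    by (intro tendsto_sum d) simp
  then have S: "(\<lambda>k. \<Sum>j\<in>{0..l}. 2 ^ (l * k) * d j k) \<longlonglongrightarrow> 0" by simp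
  have d0: "0 \<le> d j k" for j k by (simp add: d_def)
  have defect: "sum_rule_defect l A k = (MAX j\<in>{0..l}. d j k)" for k
    by (simp add: sum_rule_defect_def d_def)
  have "0 \<le> sum_rule_defect l A k" for k
  proof -
    have "d 0 k \<le> sum_rule_defect l A k" unfolding defect by (rule Max_ge) auto
    with d0 show ?thesis by (rule order.trans)
  qed
  moreover have "sum_rule_defect l A k \<le> (\<Sum>j\<in>{0..l}. d j k)" for k
    unfolding defect by (auto intro!: member_le_sum d0)
  ultimately have "norm (2 ^ (l * k) * sum_rule_defect l A k) \<le> (\<Sum>j\<in>{0..l}. 2 ^ (l * k) * d j k)" for k
    unfolding sum_distrib_left[symmetric] by (simp add: abs_mult)
  then show ?thesis
    by (intro Lim_null_comparison[OF always_eventually S]) blast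
qed

end
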